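(* Let $\theta\in\mathbb{C}$ and let $\{\theta_N\}_{N\ge1}$ be complex numbers with $\lim_{N\to\infty}\theta_N=\theta$. Let $\lambda=(\lambda_1\ge\cdots\ge\lambda_m)$ be a partition of length $m\ge1$. Let $\{f_{i,N}(x_1,\ldots,x_{N-i+1})\}_{N\ge m}$ for $1\le i\le m$ and $\{g_N(x_1,\ldots,x_N)\}_{N\ge m}$ be sequences of formal power series with $f_{i,N}\in\mathcal{F}_{N-i+1}^{N-i+1}$ and $g_N\in\mathcal{F}_N^N$ for $N\ge m$. Assume that for $1\le i\le m$ the sequence $\{s_{1,N-i+1}f_{i,N}\}_{N\ge m}$, with $s_{1,N-i+1}f_{i,N}\in\mathcal{F}_1^{N-i+1}$, is symmetric outside of $1$ with limiting sequence $f_i$, and that $\{s_{1,N}g_N\}_{N\ge m}$, with $s_{1,N}g_N\in\mathcal{F}_1^N$, is symmetric outside of $1$ with limiting sequence $g$. Then $$\lim_{N\to\infty}[1]\left(\prod_{i=1}^m\mathcal{R}_{N-i+1,N-i+1}^{\lambda_i}(f_{i,N})\right)(g_N)=\left(\sum_{\substack{\pi\in NC(\lambda_1+1)\\ \pi=B_1\sqcup\cdots\sqcup B_{\ell(\pi)}}}c_{|B_1|}(g)\prod_{j=2}^{\ell(\pi)}c_{|B_j|}(f_1)\right)\prod_{i=2}^m\left(\sum_{\substack{\pi\in NC(\lambda_i)\\ \pi=B_1\sqcup\cdots\sqcup B_{\ell(\pi)}}}\prod_{j=1}^{\ell(\pi)}c_{|B_j|}(f_i)\right).$$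
   Context: Partitions: $P$ is the set of integer partitions (including the empty one); $|\nu|,\ell(\nu)$ are size and number of parts; $P(\nu)$ is the number of distinct permutations of the tuple of parts of $\nu$. $M_\nu$ is the monomial symmetric function of $\nu$ (sum of all distinct monomials whose nonzero exponents form the multiset of parts of $\nu$). $NC(k)$ is the set of noncrossing partitions of $\{1,\ldots,k\}$; blocks $B_1,B_2,\ldots$ of $\pi$ are ordered by increasing smallest element, so $1\in B_1$; $\ell(\pi)$ is the number of blocks. $\mathcal{F}_i^N$ ($1\le i\le N$) is the set of formal power series over $\mathbb{C}$ in $x_1,\ldots,x_N$ that are symmetric in the variables $x_j$, $j\ne i$; for $F\in\mathcal{F}_i^N$, $c_F^{d,\nu}$ is the coefficient of $x_i^dM_\nu(x_j:j\ne i)$ in $F$ ($d\ge0$, $\ell(\nu)\le N-1$). $[1]F$ is the constant term of $F$. $s_{i,j}$ swaps $x_i$ and $x_j$ ($s_{1,1}$ is the identity). A sequence of formal power series, one in $\mathcal{F}_i^M$ for each sufficiently large number of variables $M$, is symmetric outside of $i$ if for all $d\ge 0,\nu\in P$ its coefficients $c^{d,\nu}$ converge as $M\to\infty$; the limits $\{c^{d,\nu}\}_{d\ge0,\nu\in P}$ form its limiting sequence outside of $i$. (Here $f_{i,N}$ has $M=N-i+1$ variables.) Operators, defined on monomials and extended linearly to formal power series: $d_i\bigl(\prod_kx_k^{a_k}\bigr)=x_i^{a_i-1}\prod_{k\ne i}x_k^{a_k}$ if $a_i\ge1$ and $0$ if $a_i=0$; for $i\neq j$, $C_{i,j}\bigl(\prod_kx_k^{a_k}\bigr)=x_i^{a_j-1}\prod_{k\ne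 i,j}x_k^{a_k}$ if $a_i=0$ and $a_j\ge1$, and $0$ otherwise. For $f\in\mathcal{F}_i^N$, $\mathcal{Q}_i^N(f)=\theta_N\sum_{1\le j\le N,\,j\ne i}\frac{d_i-C_{i,j}}{N}+f$ (with $f$ acting by multiplication), an operator $\mathcal{F}_i^N\to\mathcal{F}_i^N$. For $i\le j$, $k\ge1$ and $F,G\in\mathcal{F}_i^j$, $\mathcal{R}_{i,j}^k(F)G=\left(\mathcal{Q}_i^j(F)^kG\right)\big|_{x_i=0}$, a symmetric formal power series in $x_1,\ldots,x_{i-1},x_{i+1},\ldots,x_j$. A product $\prod_{i=1}^m\mathcal{T}_i$ of operators means $\mathcal{T}_m\circ\cdots\circ\mathcal{T}_1$. Free cumulants of a sequence $s=\{c^{d,\nu}\}_{d\ge0,\nu\in P}$: $c_k(s)=\theta^{k-1}\sum_{\nu\in P,\,d\ge0,\,|\nu|+d=k-1}(-1)^{\ell(\nu)}P(\nu)c^{d,\nu}$ for $k\ge1$ (convention $0^0=1$). *)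

theory Defs
  imports
    "HOL-Analysis.Analysis"
    "HOL-Library.Poly_Mapping"
    "HOL-Library.Disjoint_Sets"
    "HOL-Combinatorics.Combinatorics"
begin

section \<open>Integer partitions\<close>

definition partitions :: "nat list set" where
  "partitions = {\<nu>. sorted_wrt (\<ge>) \<nu> \<and> (\<forall>p\<in>set \<nu>. 0 < p)}"

definition num_perms :: "nat list \<Rightarrow> nat" where
  "num_perms \<nu> = card (permutations_of_multiset (mset \<nu>))"


section \<open>Formal power series in several variables\<close>

text \<open>
  A monomial is a finitely supported exponent function (variable \<open>x\<^sub>k\<close> has index \<open>k\<close>), and a
  formal power series is its coefficient function. The number of variables is not part of the
  type; it is recorded by the sets \<open>sym_series i N\<close> below.
\<close>

type_synonym monomial = "nat \<Rightarrow>\<^sub>0 nat"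
type_synonym mseries = "monomial \<Rightarrow> complex"

definition times_series :: "mseries \<Rightarrow> mseries \<Rightarrow> mseries" where
  "times_series F G = (\<lambda>a. \<Sum>(b, c) | b + c = a. F b * G c)"

definition const_term :: "mseries \<Rightarrow> complex" where
  "const_term F = F 0"

text \<open>The substitution \<open>x\<^sub>i = 0\<close>.\<close>

definition set_zero :: "nat \<Rightarrow> mseries \<Rightarrow> mseries" where
  "set_zero i F = (\<lambda>a. if Poly_Mapping.lookup a i = 0 then F a else 0)"

text \<open>
  The substitution \<open>x\<^sub>k \<mapsto> x\<^bsub>\<sigma> k\<^esub>\<close>, for a bijection \<open>\<sigma>\<close>: the coefficient of the image at the
  monomial \<open>b\<close> is the coefficient of the original series at \<open>b \<circ> \<sigma>\<close>.
\<close>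

definition permute_vars :: "(nat \<Rightarrow> nat) \<Rightarrow> mseries \<Rightarrow> mseries" where
  "permute_vars \<sigma> F = (\<lambda>b. F (Poly_Mapping.map_key \<sigma> b))"

definition swap_vars :: "nat \<Rightarrow> nat \<Rightarrow> mseries \<Rightarrow> mseries" where
  "swap_vars i j = permute_vars (Transposition.transpose i j)"

text \<open>The set \<open>\<F>\<^sub>i\<^sup>N\<close>: series in \<open>x\<^sub>1, \<dots>, x\<^sub>N\<close> that are symmetric in the variables other than \<open>x\<^sub>i\<close>.\<close>

definition sym_series :: "nat \<Rightarrow> nat \<Rightarrow> mseries set" where
  "sym_series i N =
     {F. (\<forall>a. F a \<noteq> 0 \<longrightarrow> Poly_Mapping.keys a \<subseteq> {1..N}) \<and>
         (\<forall>\<sigma>. \<sigma> permutes ({1..N} - {i}) \<longrightarrow> permute_vars \<sigma> F = F)}"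


section \<open>Coefficients with respect to monomial symmetric functions\<close>

definition exponents :: "monomial \<Rightarrow> nat multiset" where
  "exponents a = image_mset (Poly_Mapping.lookup a) (mset_set (Poly_Mapping.keys a))"

text \<open>The monomial symmetric function \<open>M\<^sub>\<nu>\<close> in the variables \<open>x\<^sub>j\<close>, \<open>j \<in> S\<close>.\<close>

definition monomial_sym :: "nat set \<Rightarrow> nat list \<Rightarrow> mseries" where
  "monomial_sym S \<nu> = (\<lambda>a. if Poly_Mapping.keys a \<subseteq> S \<and> exponents a = mset \<nu> then 1 else 0)"

definition var_power :: "nat \<Rightarrow> nat \<Rightarrow> mseries" where
  "var_power i d = (\<lambda>a. if a = Poly_Mapping.single i d then 1 else 0)"

text \<open>
  The coefficients \<open>c\<^sub>F\<close> of the expansion of \<open>F\<close> in the series \<open>x\<^sub>i\<^sup>d M\<^sub>\<nu>(x\<^sub>j : j \<noteq> i)\<close>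
  with \<open>\<nu>\<close> of length at most \<open>N - 1\<close>. At each monomial only one summand of the expansion can be
  nonzero, so the sum makes sense coefficientwise. For indices outside the stated range the
  coefficient is set to 0, so that the family is unique for \<open>F \<in> sym_series i N\<close>, \<open>1 \<le> i \<le> N\<close>.
\<close>

definition expansion :: "nat \<Rightarrow> nat \<Rightarrow> (nat \<Rightarrow> nat list \<Rightarrow> complex) \<Rightarrow> mseries" where
  "expansion i N c = (\<lambda>a. Sum_any (\<lambda>(d, \<nu>).
     c d \<nu> * times_series (var_power i d) (monomial_sym ({1..N} - {i}) \<nu>) a))"

definition coeff_series :: "nat \<Rightarrow> nat \<Rightarrow> mseries \<Rightarrow> nat \<Rightarrow> nat list \<Rightarrow> complex" where
  "coeff_series i N F =
     (THE c. (\<forall>d \<nu>. \<not> (\<nu> \<in> partitions \<and> length \<nu> \<le> N - 1) \<longrightarrow> c d \<nu> = 0) \<and> F = expansion i N c)"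

text \<open>
  \<open>h M\<close> is the member of the sequence with \<open>M\<close> variables. Only the values of the limiting sequence
  \<open>s\<close> at partitions are meaningful.
\<close>

definition symmetric_outside ::
    "nat \<Rightarrow> (nat \<Rightarrow> mseries) \<Rightarrow> (nat \<Rightarrow> nat list \<Rightarrow> complex) \<Rightarrow> bool" where
  "symmetric_outside i h s \<longleftrightarrow>
     (\<forall>\<^sub>F M in sequentially. h M \<in> sym_series i M) \<and>
     (\<forall>d. \<forall>\<nu>\<in>partitions. (\<lambda>M. coeff_series i M (h M) d \<nu>) \<longlonglongrightarrow> s d \<nu>)"


section \<open>Operators\<close>

text \<open>
  Linear extension to formal power series of a map sending monomials to monomials or to zero
  (\<open>None\<close>). For the two maps below every monomial has at most one preimage.
\<close>

definition lin_ext :: "(monomial \<Rightarrow> monomial option) \<Rightarrow> mseries \<Rightarrow> mseries" where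
  "lin_ext t F = (\<lambda>b. \<Sum>a | t a = Some b. F a)"

definition d_op :: "nat \<Rightarrow> mseries \<Rightarrow> mseries" where
  "d_op i = lin_ext (\<lambda>a.
     if Poly_Mapping.lookup a i \<ge> 1
     then Some (Poly_Mapping.update i (Poly_Mapping.lookup a i - 1) a) else None)"

definition C_op :: "nat \<Rightarrow> nat \<Rightarrow> mseries \<Rightarrow> mseries" where
  "C_op i j = lin_ext (\<lambda>a.
     if Poly_Mapping.lookup a i = 0 \<and> Poly_Mapping.lookup a j \<ge> 1
     then Some (Poly_Mapping.update i (Poly_Mapping.lookup a j - 1) (Poly_Mapping.update j 0 a))
     else None)"

definition Q_op :: "(nat \<Rightarrow> complex) \<Rightarrow> nat \<Rightarrow> nat \<Rightarrow> mseries \<Rightarrow> mseries \<Rightarrow> mseries" where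
  "Q_op \<theta>s i N f G =
     (\<lambda>a. \<theta>s N * (\<Sum>j\<in>{1..N} - {i}. (d_op i G a - C_op i j G a) / of_nat N) + times_series f G a)"

definition R_op :: "(nat \<Rightarrow> complex) \<Rightarrow> nat \<Rightarrow> nat \<Rightarrow> nat \<Rightarrow> mseries \<Rightarrow> mseries \<Rightarrow> mseries" where
  "R_op \<theta>s i j k F G = set_zero i ((Q_op \<theta>s i j F ^^ k) G)"

text \<open>The product of operators \<open>T\<^sub>1, \<dots>, T\<^sub>m\<close>, in which \<open>T\<^sub>1\<close> is applied first.\<close>

definition op_prod :: "nat \<Rightarrow> (nat \<Rightarrow> mseries \<Rightarrow> mseries) \<Rightarrow> mseries \<Rightarrow> mseries" where
  "op_prod m T = fold T [1..<Suc m]"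


section \<open>Free cumulants and noncrossing partitions\<close>

definition free_cumulant :: "complex \<Rightarrow> (nat \<Rightarrow> nat list \<Rightarrow> complex) \<Rightarrow> nat \<Rightarrow> complex" where
  "free_cumulant \<theta> s k =
     \<theta> ^ (k - 1) * (\<Sum>(d, \<nu>) | \<nu> \<in> partitions \<and> sum_list \<nu> + d = k - 1.
       (-1) ^ length \<nu> * of_nat (num_perms \<nu>) * s d \<nu>)"

definition NC :: "nat \<Rightarrow> nat set set set" where
  "NC k = {\<pi>. partition_on {1..k} \<pi> \<and>
     \<not> (\<exists>A\<in>\<pi>. \<exists>B\<in>\<pi>. A \<noteq> B \<and> (\<exists>a b c d. a < b \<and> b < c \<and> c < d \<and> a \<in> A \<and> c \<in> A \<and> b \<in> B \<and> d \<in> B))}"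

text \<open>The block \<open>B\<^sub>j\<close>, for \<open>j = 1, \<dots>, card \<pi>\<close>, with blocks ordered by increasing smallest element.\<close>

definition nth_block :: "nat set set \<Rightarrow> nat \<Rightarrow> nat set" where
  "nth_block \<pi> j = (THE B. B \<in> \<pi> \<and> Min B = sorted_list_of_set (Min ` \<pi>) ! (j - 1))"

end

theory Submission
  imports Defs
begin

text \<open>
  As the number of variables grows, \<open>Q\<close> converges coefficientwise to \<open>\<theta> D + f\<close>, where \<open>D\<close> maps
  \<open>x\<^sup>d M\<^sub>\<nu>\<close> to \<open>x\<^sup>d\<^sup>-\<^sup>1 M\<^sub>\<nu>\<close> for \<open>d \<ge> 1\<close> and \<open>M\<^sub>\<nu>\<close> to minus the sum of all \<open>x\<^sup>p\<^sup>-\<^sup>1 M\<^bsub>\<nu> - p\<^esub>\<close>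
  over the distinct parts \<open>p\<close> of \<open>\<nu>\<close>. The map \<open>x \<mapsto> z\<close>, \<open>M\<^sub>\<nu> \<mapsto> (-1)\<^sup>l P(\<nu>) z\<^bsup>|\<nu>|\<^esup>\<close>, with \<open>l\<close> the length
  of \<open>\<nu>\<close>, is a ring homomorphism to power series in \<open>z\<close> (it is the specialization of the symmetric
  functions at minus the one variable \<open>z\<close>); it turns \<open>D\<close> into the backward shift and the coefficients
  of \<open>f\<close> and \<open>g\<close> into their free cumulants. Hence the constant term obeys a recursion in one variable,
  which noncrossing partitions satisfy too: merge the blocks of the two smallest elements.
  A series that is symmetric in all variables has no free cumulants except \<open>c\<^sub>1\<close>, its constant term,
  so that the later factors \<open>R\<close> contribute multiplicatively.
\<close>

section \<open>Noncrossing partitions\<close>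

text \<open>Backward shift plus multiplication by a power series is Voiculescu's model of a random
  variable with given free cumulants, which is why noncrossing partitions appear. The powers of
  \<theta> in the free cumulants make \<open>\<theta> D\<close> a plain shift, since
  \<open>D\<close> lowers the degree by one. Minus one variable is the right place to specialize
  because the distinguished variable goes to z and the others, as an alphabet, to minus z: a series
  symmetric in all variables is then evaluated at z - z, the empty alphabet, and only its constant
  term survives.

  The obstacle is that only coefficients converge, while the number of variables changes at every
  factor. Limits are therefore families indexed by lists of exponents, unsorted and with zeros
  allowed. Lists make products and the removal of a variable recursive on the head, and sums over
  all compositions absorb the multiplicities P(\<nu>). Coefficients are read at monomials in the
  last variable and an initial stretch of the others, so that one list names a monomial for every
  large number of variables.\<close>

definition noncrossing :: "nat set set \<Rightarrow> bool" where
  "noncrossing \<pi> \<longleftrightarrow> \<not> (\<exists>A\<in>\<pi>. \<exists>B\<in>\<pi>. A \<noteq> B \<and>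
     (\<exists>a b c d. a < b \<and> b < c \<and> c < d \<and> a \<in> A \<and> c \<in> A \<and> b \<in> B \<and> d \<in> B))"

definition nc_partitions :: "nat set \<Rightarrow> nat set set set" where
  "nc_partitions A = {\<pi>. partition_on A \<pi> \<and> noncrossing \<pi>}"

lemma NC_eq_nc_partitions: "NC k = nc_partitions {1..k}"
  by (simp add: NC_def nc_partitions_def noncrossing_def)

lemma finite_nc_partitions: "finite A \<Longrightarrow> finite (nc_partitions A)"
  using finitely_many_partition_on[of A] by (simp add: nc_partitions_def)

lemma noncrossingI:
  assumes "\<And>A B a b c d. \<lbrakk>A \<in> \<pi>; B \<in> \<pi>; A \<noteq> B; a \<in> A; c \<in> A; b \<in> B; d \<in> B; a < b; b < c; c < d\<rbrakk> \<Longrightarrow> False"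
  shows "noncrossing \<pi>"
  unfolding noncrossing_def by (rule notI, elim bexE conjE exE) (rule assms)

lemma noncrossingD:
  assumes "noncrossing \<pi>" "A \<in> \<pi>" "B \<in> \<pi>" "a \<in> A" "c \<in> A" "b \<in> B" "d \<in> B" "a < b" "b < c" "c < d"
  shows "A = B"
proof (rule ccontr)
  assume "A \<noteq> B"
  moreover have "\<exists>a b c d. a < b \<and> b < c \<and> c < d \<and> a \<in> A \<and> c \<in> A \<and> b \<in> B \<and> d \<in> B"
    by (intro exI conjI) (fact assms)+
  ultimately have "\<exists>B\<in>\<pi>. A \<noteq> B \<and> (\<exists>a b c d. a < b \<and> b < c \<and> c < d \<and> a \<in> A \<and> c \<in> A \<and> b \<in> B \<and> d \<in> B)"
    by (intro bexI[of _ B] conjI assms(3))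
  then show False
    using assms(1) bexI[OF _ assms(2)] unfolding noncrossing_def by (elim notE)
qed

section \<open>Initial segments of finite sets of numbers\<close>

definition initial_segment :: "nat set \<Rightarrow> nat set \<Rightarrow> bool" where
  "initial_segment L C \<longleftrightarrow> L \<subseteq> C \<and> (\<forall>l\<in>L. \<forall>r\<in>C - L. l < r)"

text \<open>Two initial segments are comparable by inclusion: an element a of only the first and b
  of only the second would satisfy both a < b and b < a. Equal size then forces equality.\<close>

lemma initial_segment_unique:
  assumes "initial_segment L C" "initial_segment L' C" "finite C" "card L = card L'"
  shows "L = L'"
proof -
  have fin: "finite L" "finite L'"
    using assms by (auto simp: initial_segment_def intro: finite_subset)
  have "L \<subseteq> L' \<or> L' \<subseteq> L"
  proof (rule ccontr)
    assume "\<not> ?thesis"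
    then obtain a b where ab: "a \<in> L" "a \<notin> L'" "b \<in> L'" "b \<notin> L" by auto
    then have "a < b" "b < a" using assms(1,2) by (auto simp: initial_segment_def)
    then show False by simp
  qed
  then show ?thesis using fin assms(4) card_subset_eq by metis
qed

lemma initial_segment_exists:
  assumes "finite C" "p \<le> card C"
  shows "\<exists>L. initial_segment L C \<and> card L = p"
  using assms(2)
proof (induction p)
  case 0
  show ?case by (intro exI[of _ "{}"]) (auto simp: initial_segment_def)
next
  case (Suc p)
  then obtain L where L: "initial_segment L C" "card L = p" by auto
  have fL: "finite L" "L \<subseteq> C" using L assms by (auto simp: initial_segment_def intro: finite_subset)
  have "C - L \<noteq> {}" using L(2) Suc.prems fL by auto
  define r where "r = Min (C - L)"
  have r: "r \<in> C - L" "\<And>c. c \<in> C - L \<Longrightarrow> r \<le> c"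
    unfolding r_def using \<open>C - L \<noteq> {}\<close> assms(1) by (auto intro: Min_in Min_le simp del: Diff_iff)
  have "initial_segment (insert r L) C"
    unfolding initial_segment_def
  proof (intro conjI ballI)
    show "insert r L \<subseteq> C" using r fL by auto
    fix l q assume l: "l \<in> insert r L" and q: "q \<in> C - insert r L"
    then have "r \<noteq> q" "r \<le> q" using r(2)[of q] by auto
    then show "l < q" using l q L(1) by (auto simp: initial_segment_def)
  qed
  moreover have "card (insert r L) = Suc p" using r fL L(2) by simp
  ultimately show ?case by blast
qed

text \<open>A segment is addressed by its size, so that the ways of cutting a block are indexed by
  numbers.\<close>

definition init_seg :: "nat \<Rightarrow> nat set \<Rightarrow> nat set" where
  "init_seg p C = (SOME L. initial_segment L C \<and> card L = p)"

lemma init_seg: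
  assumes "finite C" "p \<le> card C"
  shows "initial_segment (init_seg p C) C" "card (init_seg p C) = p"
  using someI_ex[OF initial_segment_exists[OF assms]] unfolding init_seg_def by auto

lemma init_seg_eqI:
  assumes "initial_segment L C" "finite C"
  shows "init_seg (card L) C = L"
proof -
  have "card L \<le> card C" using assms by (auto simp: initial_segment_def intro: card_mono)
  then show ?thesis using initial_segment_unique init_seg assms by blast
qed

section \<open>Blocks of set partitions\<close>

lemma partition_on_unique: "\<lbrakk>partition_on A \<pi>; B \<in> \<pi>; C \<in> \<pi>; x \<in> B; x \<in> C\<rbrakk> \<Longrightarrow> B = C"
  using disjointD[of \<pi> B C] partition_onD2[of A \<pi>] by blast

definition the_block :: "nat set set \<Rightarrow> nat \<Rightarrow> nat set" where
  "the_block \<pi> y = (THE B. B \<in> \<pi> \<and> y \<in> B)"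

lemma the_block_eq: "\<lbrakk>partition_on A \<pi>; B \<in> \<pi>; y \<in> B\<rbrakk> \<Longrightarrow> the_block \<pi> y = B"
  unfolding the_block_def by (rule the_equality) (auto dest: partition_on_unique)

lemma the_block:
  assumes "partition_on A \<pi>" "y \<in> A"
  shows "the_block \<pi> y \<in> \<pi>" "y \<in> the_block \<pi> y"
proof -
  obtain B where "B \<in> \<pi>" "y \<in> B" using assms by (auto simp: partition_on_def)
  then show "the_block \<pi> y \<in> \<pi>" "y \<in> the_block \<pi> y" using the_block_eq[OF assms(1)] by auto
qed

text \<open>Splitting and merging both exchange a few blocks for new ones. The union of the new
  blocks may differ from that of the old ones, because an element enters or leaves the ground
  set.\<close>

lemma partition_on_replace:
  assumes "partition_on A \<pi>" "\<sigma> \<subseteq> \<pi>" "partition_on B \<rho>" "B \<inter> (A - \<Union>\<sigma>) = {}"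
  shows "partition_on ((A - \<Union>\<sigma>) \<union> B) ((\<pi> - \<sigma>) \<union> \<rho>)"
proof (rule partition_onI)
  have *: "\<Union>(\<pi> - \<sigma>) = A - \<Union>\<sigma>"
  proof (intro equalityI subsetI)
    fix x assume "x \<in> \<Union>(\<pi> - \<sigma>)"
    then obtain p where "x \<in> p" "p \<in> \<pi>" "p \<notin> \<sigma>" by auto
    then show "x \<in> A - \<Union>\<sigma>"
      using partition_on_unique[OF assms(1)] assms(2) partition_onD1[OF assms(1)] by blast
  next
    fix x assume "x \<in> A - \<Union>\<sigma>"
    then show "x \<in> \<Union>(\<pi> - \<sigma>)" using partition_onD1[OF assms(1)] by blast
  qed
  show "\<Union>(\<pi> - \<sigma> \<union> \<rho>) = A - \<Union>\<sigma> \<union> B"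
    using * assms(3) by (auto dest: partition_onD1)
  show "{} \<notin> \<pi> - \<sigma> \<union> \<rho>"
    using assms(1,3) by (auto dest: partition_onD3)
  have 1: "p \<subseteq> A - \<Union>\<sigma>" if "p \<in> \<pi> - \<sigma>" for p using * that by blast
  have 2: "p \<subseteq> B" if "p \<in> \<rho>" for p using assms(3) that by (auto dest: partition_onD1)
  show "disjnt p q" if "p \<in> \<pi> - \<sigma> \<union> \<rho>" "q \<in> \<pi> - \<sigma> \<union> \<rho>" "p \<noteq> q" for p q
  proof (cases "p \<in> \<pi> - \<sigma>"; cases "q \<in> \<pi> - \<sigma>")
    assume "p \<in> \<pi> - \<sigma>" "q \<in> \<pi> - \<sigma>"
    then show ?thesis using that(3) partition_on_unique[OF assms(1)] by (auto simp: disjnt_def)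
  next
    assume "p \<notin> \<pi> - \<sigma>" "q \<notin> \<pi> - \<sigma>"
    then show ?thesis using that partition_on_unique[OF assms(3)] by (auto simp: disjnt_def)
  next
    assume "p \<in> \<pi> - \<sigma>" "q \<notin> \<pi> - \<sigma>"
    then show ?thesis using 1[of p] 2[of q] that assms(4) unfolding disjnt_def by blast
  next
    assume "p \<notin> \<pi> - \<sigma>" "q \<in> \<pi> - \<sigma>"
    then show ?thesis using 1[of q] 2[of p] that assms(4) unfolding disjnt_def by blast
  qed
qed

lemma partition_on_pair:
  "\<lbrakk>P \<noteq> {}; Q \<noteq> {}; P \<inter> Q = {}\<rbrakk> \<Longrightarrow> partition_on (P \<union> Q) {P, Q}"
  by (rule partition_onI) (auto simp: disjnt_def)

text \<open>
  Let \<open>x < y\<close> be the two smallest elements. Merging the blocks of \<open>x\<close> and \<open>y\<close> and deleting \<open>x\<close>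
  maps noncrossing partitions to noncrossing partitions. The fibre over a partition in which
  the block of \<open>y\<close> is \<open>B\<close> consists of the partition with \<open>x\<close> added to \<open>B\<close> (\<open>None\<close>) and of those
  obtained by cutting \<open>B - {y}\<close> into an initial segment of size \<open>p\<close>, which stays with \<open>y\<close>, and a
  rest, which goes to \<open>x\<close> (\<open>Some p\<close>).
\<close>

definition split_block :: "nat \<Rightarrow> nat \<Rightarrow> nat set set \<Rightarrow> nat option \<Rightarrow> nat set set" where
  "split_block x y \<pi> c = (\<pi> - {the_block \<pi> y}) \<union> (case c of
      None \<Rightarrow> {insert x (the_block \<pi> y)}
    | Some p \<Rightarrow> {insert y (init_seg p (the_block \<pi> y - {y})),
                insert x (the_block \<pi> y - {y} - init_seg p (the_block \<pi> y - {y}))})"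

definition merge_blocks :: "nat \<Rightarrow> nat \<Rightarrow> nat set set \<Rightarrow> nat set set" where
  "merge_blocks x y \<pi> = (\<pi> - {the_block \<pi> x, the_block \<pi> y}) \<union>
     {(the_block \<pi> x \<union> the_block \<pi> y) - {x}}"

definition split_index :: "nat \<Rightarrow> nat \<Rightarrow> nat set set \<Rightarrow> nat option" where
  "split_index x y \<pi> =
     (if the_block \<pi> x = the_block \<pi> y then None else Some (card (the_block \<pi> y) - 1))"

text \<open>The weights are indexed by block size minus one because the free cumulant
  \<open>c_k\<close> sits in degree k - 1. The block of \<open>x\<close> has its own weight: it is
  the one that belongs to \<open>g\<close>, and the one that the recursion modifies.\<close>

definition block_weight :: "(nat \<Rightarrow> 'a) \<Rightarrow> (nat \<Rightarrow> 'a::comm_semiring_1) \<Rightarrow> nat \<Rightarrow> nat set set \<Rightarrow> 'a" where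
  "block_weight w \<kappa> x \<pi> = (\<Prod>B\<in>\<pi>. if x \<in> B then w (card B - 1) else \<kappa> (card B - 1))"

text \<open>For the power series with coefficients \<open>w\<close> and \<open>\<kappa>\<close> this
  is the backward shift of \<open>w\<close> plus the product of the two. The value at 0 of an
  iterate sums over paths from height 0 with single up steps and down steps by any p \<ge> 0 of
  weight \<open>\<kappa> p\<close>, which are reversed Lukasiewicz paths.\<close>

definition lukasiewicz_step :: "(nat \<Rightarrow> 'a) \<Rightarrow> (nat \<Rightarrow> 'a::comm_semiring_1) \<Rightarrow> nat \<Rightarrow> 'a" where
  "lukasiewicz_step \<kappa> w s = w (Suc s) + (\<Sum>p\<le>s. \<kappa> p * w (s - p))"

section \<open>The bijection behind the recursion\<close>

context
  fixes A :: "nat set" and x y :: nat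
  assumes fin: "finite A" and y: "y \<in> A" "\<And>a. a \<in> A \<Longrightarrow> y \<le> a" and xy: "x < y"
begin

lemma x_notin: "x \<notin> A"
  using y(2) xy leD by blast

lemma block_props:
  assumes "partition_on A \<pi>"
  shows "the_block \<pi> y \<in> \<pi>" "y \<in> the_block \<pi> y" "the_block \<pi> y \<subseteq> A" "finite (the_block \<pi> y)"
    "x \<notin> the_block \<pi> y"
proof -
  show *: "the_block \<pi> y \<in> \<pi>" "y \<in> the_block \<pi> y" using the_block[OF assms y(1)] by auto
  then show 2: "the_block \<pi> y \<subseteq> A" using partition_onD1[OF assms] by blast
  then show "finite (the_block \<pi> y)" using fin finite_subset by blast
  show "x \<notin> the_block \<pi> y" using 2 x_notin by blast
qed

text \<open>As \<open>x\<close> lies below everything else, it can only be the first of the four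
  elements of a crossing, and there \<open>y\<close>, the next smallest element, can replace
  it.\<close>

lemma split_block_None:
  assumes "\<pi> \<in> nc_partitions A"
  shows "split_block x y \<pi> None \<in> nc_partitions (insert x A)"
proof -
  have part: "partition_on A \<pi>" and nc: "noncrossing \<pi>" using assms by (auto simp: nc_partitions_def)
  define B where "B = the_block \<pi> y"
  note B = block_props[OF part, folded B_def]
  have eq: "split_block x y \<pi> None = (\<pi> - {B}) \<union> {insert x B}"
    by (simp add: split_block_def B_def)
  have "partition_on ((A - \<Union>{B}) \<union> insert x B) ((\<pi> - {B}) \<union> {insert x B})"
    using B x_notin by (intro partition_on_replace[OF part] partition_on_space) auto
  moreover have "(A - \<Union>{B}) \<union> insert x B = insert x A" using B by auto
  moreover have "noncrossing ((\<pi> - {B}) \<union> {insert x B})"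
  proof (rule noncrossingI)
    fix P Q a b c d
    assume PQ: "P \<in> (\<pi> - {B}) \<union> {insert x B}" "Q \<in> (\<pi> - {B}) \<union> {insert x B}" "P \<noteq> Q"
      and el: "a \<in> P" "c \<in> P" "b \<in> Q" "d \<in> Q" and lt: "a < b" "b < c" "c < d"
    have sub: "R \<subseteq> A" if "R \<in> \<pi>" for R using that partition_onD1[OF part] by blast
    consider "P \<in> \<pi>" "Q \<in> \<pi>" | "P \<in> \<pi> - {B}" "Q = insert x B" | "P = insert x B" "Q \<in> \<pi> - {B}"
      using PQ by blast
    then show False
    proof cases
      case 1
      then show False using noncrossingD[OF nc 1] el lt PQ(3) by blast
    next
      case 2
      then have "a \<in> A" using sub el by blast
      then have "x < b" "x < d" using y(2) xy lt by force+
      then have "b \<in> B" "d \<in> B" using el 2 by auto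
      then show False using noncrossingD[OF nc _ B(1)] el lt 2 by blast
    next
      case 3
      have bA: "b \<in> A" using sub el 3 by blast
      have "b \<noteq> y" using 3 el B partition_on_unique[OF part] by blast
      then have yb: "y < b" using y(2)[OF bA] by simp
      have "c \<in> B" using el 3 yb lt xy by auto
      \<comment> \<open>Since \<open>y < b\<close>, the replacement of \<open>x\<close> by
        \<open>y\<close> keeps the crossing and moves it into the old block
        \<open>B\<close>.\<close>
      define a' where "a' = (if a = x then y else a)"
      have "a' \<in> B" "a' < b" using el 3 lt yb B by (auto simp: a'_def)
      then show False using noncrossingD[OF nc B(1)] \<open>c \<in> B\<close> el lt 3 by blast
    qed
  qed
  ultimately show ?thesis by (simp add: nc_partitions_def eq)
qed

text \<open>Against an old block, each piece crosses only if \<open>B\<close> already did, with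
  \<open>y\<close> in place of \<open>x\<close>. The two pieces do not cross each other, because
  \<open>x\<close> precedes \<open>y\<close> and \<open>L\<close>, which in turn precede all of
  \<open>R\<close>.\<close>

lemma split_block_Some:
  assumes "\<pi> \<in> nc_partitions A" "p \<le> card (the_block \<pi> y) - 1"
  shows "split_block x y \<pi> (Some p) \<in> nc_partitions (insert x A)"
proof -
  have part: "partition_on A \<pi>" and nc: "noncrossing \<pi>" using assms by (auto simp: nc_partitions_def)
  define B where "B = the_block \<pi> y"
  note B = block_props[OF part, folded B_def]
  define L where "L = init_seg p (B - {y})"
  define R where "R = B - {y} - L"
  have "p \<le> card (B - {y})" using assms(2) B by (simp add: B_def)
  then have "initial_segment L (B - {y})" unfolding L_def using init_seg B by blast
  then have L: "L \<subseteq> B - {y}" and LR: "\<And>l r. l \<in> L \<Longrightarrow> r \<in> R \<Longrightarrow> l < r"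
    by (auto simp: initial_segment_def R_def)
  have BLR: "B = insert y (L \<union> R)" using L B by (auto simp: R_def)
  have yR: "y < r" if "r \<in> R" for r using that y(2)[of r] B by (force simp: R_def)
  have yL: "y < r" if "r \<in> L" for r using that y(2)[of r] B L by force
  have eq: "split_block x y \<pi> (Some p) = (\<pi> - {B}) \<union> {insert y L, insert x R}"
    by (simp add: split_block_def B_def L_def R_def)
  have xLR: "x \<notin> L" "x \<notin> R" "y \<notin> L" "y \<notin> R" "x \<noteq> y" 
  proof -
    show "y \<notin> L" "y \<notin> R" "x \<noteq> y" using L xy by (auto simp: R_def)
    show "x \<notin> L" "x \<notin> R" using B(5) L by (auto simp: R_def)
  qed
  have "L \<inter> R = {}" by (auto simp: R_def)
  then have "partition_on ((A - \<Union>{B}) \<union> (insert y L \<union> insert x R)) ((\<pi> - {B}) \<union> {insert y L, insert x R})"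
  proof (intro partition_on_replace[OF part] partition_on_pair)
    show "{B} \<subseteq> \<pi>" using B(1) by simp
    show "(insert y L \<union> insert x R) \<inter> (A - \<Union>{B}) = {}" using BLR x_notin by blast
  qed (use xLR in auto)
  moreover have "(A - \<Union>{B}) \<union> (insert y L \<union> insert x R) = insert x A" using B(3) BLR by blast
  moreover have "noncrossing ((\<pi> - {B}) \<union> {insert y L, insert x R})"
  proof (rule noncrossingI)
    fix P Q a b c d
    assume PQ: "P \<in> (\<pi> - {B}) \<union> {insert y L, insert x R}" "Q \<in> (\<pi> - {B}) \<union> {insert y L, insert x R}" "P \<noteq> Q"
      and el: "a \<in> P" "c \<in> P" "b \<in> Q" "d \<in> Q" and lt: "a < b" "b < c" "c < d"
    have sub: "R \<subseteq> A" if "R \<in> \<pi>" for R using that partition_onD1[OF part] by blast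
    have yL': "insert y L \<subseteq> B" using BLR by auto
    have P: "P \<in> \<pi> - {B} \<or> P = insert y L \<or> P = insert x R" using PQ(1) by blast
    have Q: "Q \<in> \<pi> - {B} \<or> Q = insert y L \<or> Q = insert x R" using PQ(2) by blast
    consider "P \<in> \<pi>" "Q \<in> \<pi>" | "P \<in> \<pi> - {B}" "Q = insert x R" | "P = insert x R" "Q \<in> \<pi> - {B}"
      | "P \<in> \<pi> - {B}" "Q = insert y L" | "P = insert y L" "Q \<in> \<pi> - {B}"
      | "P = insert y L" "Q = insert x R" | "P = insert x R" "Q = insert y L"
      using P Q PQ(3) by (elim disjE) (simp_all only: Diff_iff, blast+)
    then show False
    proof cases
      case 1
      then show False using noncrossingD[OF nc 1] el lt PQ(3) by blast
    next
      case 2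
      then have "a \<in> A" using sub el by blast
      then have "x < b" "x < d" using y(2) xy lt by force+
      then have "b \<in> B" "d \<in> B" using el 2 BLR by auto
      then show False using noncrossingD[OF nc _ B(1)] el lt 2 by blast
    next
      case 3
      have bA: "b \<in> A" using sub el 3 by blast
      have "b \<noteq> y" using 3 el B partition_on_unique[OF part] by blast
      then have yb: "y < b" using y(2)[OF bA] by simp
      have "c \<in> B" using el 3 yb lt xy BLR by auto
      define a' where "a' = (if a = x then y else a)"
      have "a' \<in> B" "a' < b" using el 3 lt yb BLR by (auto simp: a'_def)
      then show False using noncrossingD[OF nc B(1)] \<open>c \<in> B\<close> el lt 3 by blast
    next
      case 4
      then show False using noncrossingD[OF nc _ B(1)] el lt yL' by blast
    next
      case 5
      then show False using noncrossingD[OF nc B(1)] el lt yL' by blast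
    next
      case 6
      have "y \<le> a" using el 6 yL by force
      then have "b \<in> R" using el 6 lt xy by auto
      then have "c < b" if "c \<in> L" using LR that by blast
      moreover have "y < b" using yR \<open>b \<in> R\<close> by blast
      ultimately show False using el 6 lt by auto
    next
      case 7
      have "y \<le> b" using el 7 yL by force
      then have "c \<in> R" using el 7 lt xy by auto
      then have "d < c" if "d \<in> L" using LR that by blast
      moreover have "y < c" using yR \<open>c \<in> R\<close> by blast
      ultimately show False using el 7 lt by auto
    qed
  qed
  ultimately show ?thesis by (simp add: nc_partitions_def eq)
qed

text \<open>If the blocks X of \<open>x\<close> and Y of \<open>y\<close> differ, all of Y comes
  before the rest of X. This ordering excludes new crossings of the merged block, and it makes the
  part of Y an initial segment, so that its size suffices to undo the merging.\<close>

lemma merge_blocks: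
  assumes "\<pi> \<in> nc_partitions (insert x A)"
  shows "merge_blocks x y \<pi> \<in> nc_partitions A"
    and "the_block (merge_blocks x y \<pi>) y = (the_block \<pi> x \<union> the_block \<pi> y) - {x}"
    and "the_block \<pi> x \<noteq> the_block \<pi> y \<Longrightarrow> initial_segment (the_block \<pi> y - {y})
      ((the_block \<pi> x \<union> the_block \<pi> y) - {x, y})"
proof -
  have part: "partition_on (insert x A) \<pi>" and nc: "noncrossing \<pi>"
    using assms by (auto simp: nc_partitions_def)
  define X where "X = the_block \<pi> x"
  define Y where "Y = the_block \<pi> y"
  have X: "X \<in> \<pi>" "x \<in> X" and Y: "Y \<in> \<pi>" "y \<in> Y"
    using the_block[OF part] y(1) by (auto simp: X_def Y_def)
  have sub: "P \<subseteq> insert x A" if "P \<in> \<pi>" for P using that partition_onD1[OF part] by blast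
  define B where "B = (X \<union> Y) - {x}"
  have eq: "merge_blocks x y \<pi> = (\<pi> - {X, Y}) \<union> {B}"
    by (simp add: merge_blocks_def X_def Y_def B_def)
  have yB: "y \<in> B" using Y xy by (auto simp: B_def)
  have xnot: "x \<notin> P" if "P \<in> \<pi> - {X}" for P
    using that X partition_on_unique[OF part] by blast
  \<comment> \<open>Otherwise \<open>x < y < a < b\<close> would be a crossing of \<open>X\<close>
    and \<open>Y\<close>.\<close>
  have YX: "b < a" if "X \<noteq> Y" "b \<in> Y" "a \<in> X - {x}" for a b
  proof (rule ccontr)
    assume "\<not> b < a"
    moreover have "a \<noteq> b" using that X Y partition_on_unique[OF part] by blast
    ultimately have "a < b" by simp
    have "a \<in> A" using sub[OF X(1)] that by blast
    moreover have "a \<noteq> y" using that X Y partition_on_unique[OF part] by blast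
    ultimately have "y < a" using y(2)[of a] by simp
    then show False
      using noncrossingD[OF nc X(1) Y(1) X(2) _ Y(2) that(2) xy, of a] that \<open>a < b\<close> by blast
  qed
  have "partition_on ((insert x A - \<Union>{X, Y}) \<union> B) ((\<pi> - {X, Y}) \<union> {B})"
    using yB X Y by (intro partition_on_replace[OF part] partition_on_space) (auto simp: B_def)
  moreover have "(insert x A - \<Union>{X, Y}) \<union> B = A"
    using sub[OF X(1)] sub[OF Y(1)] X x_notin by (auto simp: B_def)
  moreover have "noncrossing ((\<pi> - {X, Y}) \<union> {B})"
  proof (rule noncrossingI)
    fix P Q a b c d
    assume PQ: "P \<in> (\<pi> - {X, Y}) \<union> {B}" "Q \<in> (\<pi> - {X, Y}) \<union> {B}" "P \<noteq> Q"
      and el: "a \<in> P" "c \<in> P" "b \<in> Q" "d \<in> Q" and lt: "a < b" "b < c" "c < d"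
    consider "P \<in> \<pi>" "Q \<in> \<pi>" | "P \<in> \<pi> - {X, Y}" "Q = B" | "P = B" "Q \<in> \<pi> - {X, Y}"
      using PQ by blast
    then show False
    proof cases
      case 1
      then show False using noncrossingD[OF nc 1] el lt PQ(3) by blast
    next
      case 2
      consider "b \<in> X" "d \<in> X" | "b \<in> Y" "d \<in> Y" | "b \<in> Y" "d \<in> X - {x}" "X \<noteq> Y"
        | "b \<in> X - {x}" "d \<in> Y" "X \<noteq> Y"
        using el 2 by (auto simp: B_def)
      then show False
      proof cases
        case 1
        then show False using noncrossingD[OF nc _ X(1)] el lt 2 by blast
      next
        case 22: 2
        then show False using noncrossingD[OF nc _ Y(1)] el lt 2 by blast
      next
        case 3
        have "a \<in> A" using sub[of P] 2 el xnot[of P] by blast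
        moreover have "a \<noteq> y" using 2 el Y partition_on_unique[OF part] by blast
        ultimately have "y < a" using y(2)[of a] by simp
        \<comment> \<open>Here \<open>y < a < b < c\<close> is already a crossing of
          \<open>Y\<close> and \<open>P\<close>.\<close>
        then have "Y = P" using noncrossingD[OF nc Y(1) _ Y(2) 3(1) el(1,2)] lt 2 by blast
        then show False using 2 by blast
      next
        case 4
        then show False using YX[of d b] lt by simp
      qed
    next
      case 3
      consider "a \<in> X" "c \<in> X" | "a \<in> Y" "c \<in> Y" | "a \<in> Y" "c \<in> X - {x}" "X \<noteq> Y"
        | "a \<in> X - {x}" "c \<in> Y" "X \<noteq> Y"
        using el 3 by (auto simp: B_def)
      then show False
      proof cases
        case 1
        then show False using noncrossingD[OF nc X(1)] el lt 3 by blast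
      next
        case 2
        then show False using noncrossingD[OF nc Y(1)] el lt 3 by blast
      next
        case 33: 3
        have "a \<noteq> x" using xnot[of Y] 33 Y by auto
        then have "a \<in> A" using sub[of Y] 33 Y by blast
        then have "x < b" using y(2)[of a] xy lt by simp
        \<comment> \<open>Here \<open>x < b < c < d\<close> is already a crossing of
          \<open>X\<close> and \<open>Q\<close>.\<close>
        then show False using noncrossingD[OF nc X(1) _ X(2) _ el(3,4)] 33 3 lt by blast
      next
        case 4
        then show False using YX[of c a] lt by simp
      qed
    qed
  qed
  ultimately show mem: "merge_blocks x y \<pi> \<in> nc_partitions A" by (simp add: nc_partitions_def eq)
  show "the_block (merge_blocks x y \<pi>) y = (the_block \<pi> x \<union> the_block \<pi> y) - {x}"
    using mem yB eq by (intro the_block_eq[of A]) (auto simp: nc_partitions_def B_def X_def Y_def)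
  assume "the_block \<pi> x \<noteq> the_block \<pi> y"
  then have ne: "X \<noteq> Y" by (simp add: X_def Y_def)
  then have "Y - {y} \<subseteq> (X \<union> Y) - {x, y}" using xnot[of Y] Y by blast
  then show "initial_segment (the_block \<pi> y - {y}) ((the_block \<pi> x \<union> the_block \<pi> y) - {x, y})"
    unfolding initial_segment_def X_def[symmetric] Y_def[symmetric] using YX ne by blast
qed
lemma merge_blocks_split_block:
  assumes "\<pi> \<in> nc_partitions A" "c = None \<or> (\<exists>p \<le> card (the_block \<pi> y) - 1. c = Some p)"
  shows "merge_blocks x y (split_block x y \<pi> c) = \<pi>"
    and "split_index x y (split_block x y \<pi> c) = c"
proof -
  have part: "partition_on A \<pi>" using assms by (auto simp: nc_partitions_def)
  define B where "B = the_block \<pi> y"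
  note B = block_props[OF part, folded B_def]
  have xB: "B \<noteq> insert x C" "insert x C \<noteq> B" for C using B(5) by auto
  have new: "C \<notin> \<pi>" if "x \<in> C" for C using that partition_onD1[OF part] x_notin by blast
  have uniq: "C = B" if "C \<in> \<pi>" "y \<in> C" for C using that B partition_on_unique[OF part] by blast
  have "merge_blocks x y (split_block x y \<pi> c) = \<pi> \<and> split_index x y (split_block x y \<pi> c) = c"
  proof (cases c)
    case None
    have mem: "partition_on (insert x A) (split_block x y \<pi> None)"
      using split_block_None[OF assms(1)] by (simp add: nc_partitions_def)
    have eq: "split_block x y \<pi> None = (\<pi> - {B}) \<union> {insert x B}"
      by (simp add: split_block_def B_def)
    have x: "the_block (split_block x y \<pi> None) x = insert x B"
      by (rule the_block_eq[OF mem]) (auto simp: eq)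
    have y': "the_block (split_block x y \<pi> None) y = insert x B"
      by (rule the_block_eq[OF mem]) (auto simp: eq B(2))
    have "insert x B - {x} = B" using B(5) by simp
    moreover have "(\<pi> - {B}) \<union> {insert x B} - {insert x B} = \<pi> - {B}"
      using new[of "insert x B"] by blast
    ultimately have "merge_blocks x y (split_block x y \<pi> None) = (\<pi> - {B}) \<union> {B}"
      unfolding merge_blocks_def x y' unfolding eq by (simp only: Un_absorb insert_absorb2)
    also have "\<dots> = \<pi>" using B(1) by blast
    finally show ?thesis using None x y' by (simp add: split_index_def)
  next
    case (Some p)
    then have p: "p \<le> card (the_block \<pi> y) - 1" using assms(2) by simp
    have mem: "partition_on (insert x A) (split_block x y \<pi> (Some p))"
      using split_block_Some[OF assms(1) p] by (simp add: nc_partitions_def)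
    define L where "L = init_seg p (B - {y})"
    define R where "R = B - {y} - L"
    have "p \<le> card (B - {y})" using p B by (simp add: B_def)
    then have L: "initial_segment L (B - {y})" "card L = p" unfolding L_def using init_seg B by blast+
    then have L': "L \<subseteq> B - {y}" by (simp add: initial_segment_def)
    have eq: "split_block x y \<pi> (Some p) = (\<pi> - {B}) \<union> {insert y L, insert x R}"
      by (simp add: split_block_def B_def L_def R_def)
    have x: "the_block (split_block x y \<pi> (Some p)) x = insert x R"
      by (rule the_block_eq[OF mem]) (auto simp: eq)
    have y': "the_block (split_block x y \<pi> (Some p)) y = insert y L"
      by (rule the_block_eq[OF mem]) (auto simp: eq)
    have "x \<notin> insert y L" using B(5) L' xy by blast
    then have ne: "insert x R \<noteq> insert y L" by blast
    have "insert x R \<union> insert y L - {x} = B" using B(5,2) L' xy by (auto simp: R_def)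
    \<comment> \<open>The difference must not delete an untouched block: none of them contains
      \<open>x\<close>, which is outside \<open>A\<close>, or \<open>y\<close>, whose only old block
      is \<open>B\<close>.\<close>
    moreover have "(\<pi> - {B}) \<union> {insert y L, insert x R} - {insert x R, insert y L} = \<pi> - {B}"
      using new[of "insert x R"] uniq[of "insert y L"] by blast
    ultimately have "merge_blocks x y (split_block x y \<pi> (Some p)) = (\<pi> - {B}) \<union> {B}"
      unfolding merge_blocks_def x y' unfolding eq by (simp only:)
    also have "\<dots> = \<pi>" using B(1) by blast
    moreover have "finite L" "y \<notin> L" using L' B(4) finite_subset by blast+
    then have "card (insert y L) - 1 = p" using L by simp
    ultimately show ?thesis using Some x y' ne by (simp add: split_index_def)
  qed
  then show "merge_blocks x y (split_block x y \<pi> c) = \<pi>"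
    and "split_index x y (split_block x y \<pi> c) = c" by auto
qed

text \<open>The cut is recovered from its size alone because \<open>Y - {y}\<close> is an initial
  segment of the merged block without \<open>y\<close>, and initial segments are determined by their
  size.\<close>

lemma split_block_merge_blocks:
  assumes "\<pi> \<in> nc_partitions (insert x A)"
  defines "\<rho> \<equiv> merge_blocks x y \<pi>" and "c \<equiv> split_index x y \<pi>"
  shows "split_block x y \<rho> c = \<pi>"
    and "c = None \<or> (\<exists>p \<le> card (the_block \<rho> y) - 1. c = Some p)"
proof -
  have part: "partition_on (insert x A) \<pi>" using assms by (auto simp: nc_partitions_def)
  define X where "X = the_block \<pi> x"
  define Y where "Y = the_block \<pi> y"
  have X: "X \<in> \<pi>" "x \<in> X" and Y: "Y \<in> \<pi>" "y \<in> Y"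
    using the_block[OF part] y(1) by (auto simp: X_def Y_def)
  have sub: "P \<subseteq> insert x A" if "P \<in> \<pi>" for P using that partition_onD1[OF part] by blast
  have fin': "finite X" "finite Y" using sub[OF X(1)] sub[OF Y(1)] fin finite_subset by blast+
  define B where "B = (X \<union> Y) - {x}"
  have eq: "\<rho> = (\<pi> - {X, Y}) \<union> {B}"
    by (simp add: merge_blocks_def X_def Y_def B_def \<rho>_def)
  have B: "the_block \<rho> y = B"
    using merge_blocks(2)[OF assms(1)] by (simp add: \<rho>_def B_def X_def Y_def)
  have "split_block x y \<rho> c = \<pi> \<and> (c = None \<or> (\<exists>p \<le> card (the_block \<rho> y) - 1. c = Some p))"
  proof (cases "X = Y")
    case True
    then have c: "c = None" by (simp add: c_def split_index_def X_def Y_def)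
    \<comment> \<open>Deleting \<open>B\<close> from \<open>\<rho>\<close> must give back exactly
      the blocks that the merging left alone, so \<open>B\<close> must not be among them.\<close>
    have "B \<notin> \<pi>"
    proof
      assume "B \<in> \<pi>"
      moreover have "y \<in> B" using Y xy by (simp add: B_def)
      ultimately have "B = Y" using Y partition_on_unique[OF part] by blast
      then show False using X True by (auto simp: B_def)
    qed
    moreover have "insert x B = X" using True X by (auto simp: B_def)
    ultimately have "split_block x y \<rho> None = (\<pi> - {X}) \<union> {X}"
      unfolding split_block_def B using True by (simp add: eq)
    also have "\<dots> = \<pi>" using X by blast
    finally show ?thesis using c by simp
  next
    case False
    have disj: "X \<inter> Y = {}" using X Y False partition_on_unique[OF part] by blast
    have c: "c = Some (card Y - 1)" using False by (simp add: c_def split_index_def X_def Y_def)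
    have "initial_segment (Y - {y}) ((X \<union> Y) - {x, y})"
      using merge_blocks(3)[OF assms(1)] False by (simp add: X_def Y_def)
    also have "(X \<union> Y) - {x, y} = B - {y}" by (auto simp: B_def)
    finally have "initial_segment (Y - {y}) (B - {y})" .
    moreover have "finite (B - {y})" using fin' by (simp add: B_def)
    ultimately have "init_seg (card (Y - {y})) (B - {y}) = Y - {y}" by (rule init_seg_eqI)
    then have seg: "init_seg (card Y - 1) (B - {y}) = Y - {y}" using Y by simp
    have R: "B - {y} - (Y - {y}) = X - {x}" using disj Y X by (auto simp: B_def)
    have ins: "insert y (Y - {y}) = Y" "insert x (X - {x}) = X" using X Y by auto
    have "B \<notin> \<pi> - {X, Y}"
    proof
      assume "B \<in> \<pi> - {X, Y}"
      moreover have "y \<in> B" using Y xy by (simp add: B_def)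
      ultimately show False using Y partition_on_unique[OF part] by blast
    qed
    then have "split_block x y \<rho> c = (\<pi> - {X, Y}) \<union> {Y, X}"
      unfolding split_block_def B c option.case seg R ins by (auto simp: eq)
    also have "\<dots> = \<pi>" using X Y by blast
    finally have 1: "split_block x y \<rho> c = \<pi>" .
    have "Y \<subseteq> B" using disj X by (auto simp: B_def)
    then have "card Y \<le> card B" using fin' by (intro card_mono) (auto simp: B_def)
    then show ?thesis using 1 c B by auto
  qed
  then show "split_block x y \<rho> c = \<pi>"
    and "c = None \<or> (\<exists>p \<le> card (the_block \<rho> y) - 1. c = Some p)" by auto
qed

text \<open>The block of \<open>y\<close> has s + 1 elements. Adding \<open>x\<close> raises the
  index of the marked block to s + 1; a cut leaves an ordinary block of index p at \<open>y\<close>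
  and a marked block of index s - p at \<open>x\<close>. The other blocks contribute
  \<open>r\<close> throughout, so the total over a fibre is
  \<open>lukasiewicz_step \<kappa> w s * r\<close>.\<close>

lemma block_weight_split:
  fixes \<kappa> w :: "nat \<Rightarrow> 'a::comm_semiring_1"
  assumes "\<pi> \<in> nc_partitions A"
  defines "s \<equiv> card (the_block \<pi> y) - 1"
    and "r \<equiv> (\<Prod>B\<in>\<pi> - {the_block \<pi> y}. \<kappa> (card B - 1))"
  shows "block_weight w \<kappa> x (split_block x y \<pi> None) = w (Suc s) * r"
    and "p \<le> s \<Longrightarrow> block_weight w \<kappa> x (split_block x y \<pi> (Some p)) = \<kappa> p * w (s - p) * r"
    and "block_weight w \<kappa> y \<pi> = w s * r"
proof -
  have part: "partition_on A \<pi>" using assms by (auto simp: nc_partitions_def)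
  have fpi: "finite \<pi>" using finite_elements[OF fin part] .
  define B where "B = the_block \<pi> y"
  note B = block_props[OF part, folded B_def]
  have new: "C \<notin> \<pi>" if "x \<in> C" for C using that partition_onD1[OF part] x_notin by blast
  have uniq: "C = B" if "C \<in> \<pi>" "y \<in> C" for C using that B partition_on_unique[OF part] by blast
  have sB: "card B = Suc s" using B(2,4) by (simp add: s_def B_def[symmetric] card_gt_0_iff) (metis card_Suc_Diff1 card_gt_0_iff empty_iff Suc_pred)
  have r: "(\<Prod>C\<in>\<pi> - {B}. if z \<in> C then w (card C - 1) else \<kappa> (card C - 1)) = r" if "z = x \<or> z = y" for z
    unfolding r_def B_def[symmetric] using new uniq that by (intro prod.cong) auto
  have "split_block x y \<pi> None = insert (insert x B) (\<pi> - {B})"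
    by (simp add: split_block_def B_def)
  then have "block_weight w \<kappa> x (split_block x y \<pi> None) = w (card (insert x B) - 1) * r"
    using new[of "insert x B"] fpi r[of x] by (simp add: block_weight_def)
  then show "block_weight w \<kappa> x (split_block x y \<pi> None) = w (Suc s) * r"
    using B sB by simp
  have "block_weight w \<kappa> y \<pi> = w s * r"
    unfolding block_weight_def by (subst prod.remove[OF fpi B(1)]) (use r[of y] B(2) sB in simp)
  then show "block_weight w \<kappa> y \<pi> = w s * r" .
  assume p: "p \<le> s"
  define L where "L = init_seg p (B - {y})"
  define R where "R = B - {y} - L"
  have "p \<le> card (B - {y})" using p B sB by simp
  then have L: "initial_segment L (B - {y})" "card L = p" unfolding L_def using init_seg B by blast+
  then have L': "L \<subseteq> B - {y}" by (simp add: initial_segment_def)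
  have eq: "split_block x y \<pi> (Some p) = insert (insert x R) (insert (insert y L) (\<pi> - {B}))"
    by (auto simp add: split_block_def B_def L_def R_def)
  have fl: "finite L" "finite R" using L' B(4) by (auto simp: R_def intro: finite_subset)
  have "x \<notin> insert y L" "x \<notin> R" "y \<notin> L" using B(5) L' xy by (auto simp: R_def)
  moreover from this have "insert x R \<noteq> insert y L" by blast
  moreover have "insert y L \<notin> \<pi> - {B}" "insert x R \<notin> \<pi> - {B}" using uniq new by blast+
  moreover have "card R = s - p" using card_Diff_subset[OF fl(1) L'] L B sB by (simp add: R_def)
  ultimately show "block_weight w \<kappa> x (split_block x y \<pi> (Some p)) = \<kappa> p * w (s - p) * r"
    unfolding block_weight_def eq using fpi fl r[of x] L(2) by (simp add: ac_simps)
qed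

text \<open>Summing over the fibres of the merging map moves the mark from \<open>x\<close> to
  \<open>y\<close>; the effect on the weights is confined to that of the marked block.\<close>

lemma sum_block_weight_step:
  fixes \<kappa> w :: "nat \<Rightarrow> 'a::comm_semiring_1"
  shows "(\<Sum>\<pi>\<in>nc_partitions (insert x A). block_weight w \<kappa> x \<pi>) =
         (\<Sum>\<pi>\<in>nc_partitions A. block_weight (lukasiewicz_step \<kappa> w) \<kappa> y \<pi>)"
proof -
  \<comment> \<open>\<open>C \<pi>\<close> indexes the fibre over \<open>\<pi>\<close>; the sizes 0
    and card - 1 are both allowed and make \<open>y\<close> or \<open>x\<close> a singleton
    block.\<close>
  define C where "C \<pi> = insert None (Some ` {..card (the_block \<pi> y) - 1})" for \<pi> :: "nat set set"
  have "(\<Sum>\<pi>\<in>nc_partitions (insert x A). block_weight w \<kappa> x \<pi>) =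
        (\<Sum>(\<pi>, c)\<in>Sigma (nc_partitions A) C. block_weight w \<kappa> x (split_block x y \<pi> c))"
  proof (rule sum.reindex_bij_witness[where i = "\<lambda>(\<pi>, c). split_block x y \<pi> c"
        and j = "\<lambda>\<pi>. (merge_blocks x y \<pi>, split_index x y \<pi>)"])
    fix \<pi> assume \<pi>: "\<pi> \<in> nc_partitions (insert x A)"
    note * = split_block_merge_blocks[OF \<pi>]
    show "(case (merge_blocks x y \<pi>, split_index x y \<pi>) of (\<pi>, c) \<Rightarrow> split_block x y \<pi> c) = \<pi>"
      using *(1) by simp
    show "(case (merge_blocks x y \<pi>, split_index x y \<pi>) of (\<pi>, c) \<Rightarrow>
            block_weight w \<kappa> x (split_block x y \<pi> c)) = block_weight w \<kappa> x \<pi>"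
      using *(1) by simp
    show "(merge_blocks x y \<pi>, split_index x y \<pi>) \<in> Sigma (nc_partitions A) C"
      using *(2) merge_blocks(1)[OF \<pi>] by (auto simp: C_def)
  next
    fix z assume "z \<in> Sigma (nc_partitions A) C"
    then obtain \<pi> c where z: "z = (\<pi>, c)" "\<pi> \<in> nc_partitions A" "c \<in> C \<pi>" by auto
    then have c: "c = None \<or> (\<exists>p \<le> card (the_block \<pi> y) - 1. c = Some p)" by (auto simp: C_def)
    show "(merge_blocks x y (case z of (\<pi>, c) \<Rightarrow> split_block x y \<pi> c),
           split_index x y (case z of (\<pi>, c) \<Rightarrow> split_block x y \<pi> c)) = z"
      using merge_blocks_split_block[OF z(2) c] z by simp
    show "(case z of (\<pi>, c) \<Rightarrow> split_block x y \<pi> c) \<in> nc_partitions (insert x A)"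
      using split_block_None[OF z(2)] split_block_Some[OF z(2)] c z(1) by auto
  qed
  also have "\<dots> = (\<Sum>\<pi>\<in>nc_partitions A. \<Sum>c\<in>C \<pi>. block_weight w \<kappa> x (split_block x y \<pi> c))"
    using finite_nc_partitions[OF fin] by (intro sum.Sigma[symmetric]) (auto simp: C_def)
  also have "\<dots> = (\<Sum>\<pi>\<in>nc_partitions A. block_weight (lukasiewicz_step \<kappa> w) \<kappa> y \<pi>)"
  proof (rule sum.cong[OF refl])
    fix \<pi> assume \<pi>: "\<pi> \<in> nc_partitions A"
    have "(\<Sum>c\<in>C \<pi>. block_weight w \<kappa> x (split_block x y \<pi> c)) =
      block_weight w \<kappa> x (split_block x y \<pi> None) +
      (\<Sum>p\<le>card (the_block \<pi> y) - 1. block_weight w \<kappa> x (split_block x y \<pi> (Some p)))"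
      unfolding C_def by (subst sum.insert) (auto simp: sum.reindex)
    also have "\<dots> = block_weight (lukasiewicz_step \<kappa> w) \<kappa> y \<pi>"
      by (simp add: block_weight_split[OF \<pi>] lukasiewicz_step_def distrib_right sum_distrib_right)
    finally show "(\<Sum>c\<in>C \<pi>. block_weight w \<kappa> x (split_block x y \<pi> c)) =
      block_weight (lukasiewicz_step \<kappa> w) \<kappa> y \<pi>" .
  qed
  finally show ?thesis .
qed

end

lemma nc_partitions_singleton: "nc_partitions {x} = {{{x}}}"
proof -
  have "partition_on {x} \<pi> \<longleftrightarrow> \<pi> = {{x}}" for \<pi> :: "nat set set"
  proof
    assume p: "partition_on {x} \<pi>"
    have "C = {x}" if "C \<in> \<pi>" for C
      using partition_onD1[OF p] partition_onD3[OF p] that by (metis Union_upper subset_singletonD)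
    moreover have "\<pi> \<noteq> {}" using partition_onD1[OF p] by auto
    ultimately show "\<pi> = {{x}}" by blast
  qed (auto intro: partition_on_space)
  moreover have "noncrossing {{x}}" by (rule noncrossingI) auto
  ultimately show ?thesis by (auto simp: nc_partitions_def)
qed

text \<open>Each step removes the smallest element, hence the arbitrary starting point. An interval
  of k + 1 elements needs k steps to become a singleton, whose only block has index 0.\<close>

lemma sum_block_weight:
  "(\<Sum>\<pi>\<in>nc_partitions {i..i + k}. block_weight w \<kappa> i \<pi>) = (lukasiewicz_step \<kappa> ^^ k) w 0"
proof (induction k arbitrary: i w)
  case 0
  show ?case by (simp add: nc_partitions_singleton block_weight_def)
next
  case (Suc k)
  have "{i..i + Suc k} = insert i {Suc i..Suc i + k}" by auto
  then have "(\<Sum>\<pi>\<in>nc_partitions {i..i + Suc k}. block_weight w \<kappa> i \<pi>) =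
    (\<Sum>\<pi>\<in>nc_partitions {Suc i..Suc i + k}. block_weight (lukasiewicz_step \<kappa> w) \<kappa> (Suc i) \<pi>)"
    by (simp only:) (rule sum_block_weight_step, auto)
  also have "\<dots> = (lukasiewicz_step \<kappa> ^^ Suc k) w 0"
    by (simp only: Suc.IH funpow_Suc_right o_apply)
  finally show ?case .
qed

section \<open>Enumerating blocks by their smallest elements\<close>

lemma nth_block_bij:
  assumes part: "partition_on {1..k} \<pi>"
  shows "bij_betw (nth_block \<pi>) {1..card \<pi>} \<pi>"
    and "k \<ge> 1 \<Longrightarrow> 1 \<in> nth_block \<pi> 1"
proof -
  have fpi: "finite \<pi>" using finite_elements[OF _ part] by simp
  have sub: "B \<subseteq> {1..k}" if "B \<in> \<pi>" for B using that partition_onD1[OF part] by blast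
  have Min: "Min B \<in> B" if "B \<in> \<pi>" for B
    using that partition_onD3[OF part] sub[OF that] finite_subset by (intro Min_in) auto
  then have inj: "inj_on Min \<pi>"
    using partition_on_unique[OF part] by (intro inj_onI) metis
  define l where "l = sorted_list_of_set (Min ` \<pi>)"
  have l: "distinct l" "set l = Min ` \<pi>" "length l = card \<pi>"
    using fpi inj by (auto simp: l_def card_image)
  have "bij_betw (\<lambda>j. j - 1) {1..card \<pi>} {..<card \<pi>}"
    by (rule bij_betw_byWitness[where f' = Suc]) auto
  moreover have "bij_betw ((!) l) {..<card \<pi>} (Min ` \<pi>)"
    using bij_betw_nth[OF l(1)] l by auto
  ultimately have "bij_betw ((!) l \<circ> (\<lambda>j. j - 1)) {1..card \<pi>} (Min ` \<pi>)"
    by (rule bij_betw_trans)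
  moreover have "bij_betw (the_inv_into \<pi> Min) (Min ` \<pi>) \<pi>"
    using inj by (intro bij_betw_the_inv_into) (simp add: bij_betw_def)
  ultimately have "bij_betw (the_inv_into \<pi> Min \<circ> ((!) l \<circ> (\<lambda>j. j - 1))) {1..card \<pi>} \<pi>"
    by (rule bij_betw_trans)
  moreover have "the_inv_into \<pi> Min \<circ> ((!) l \<circ> (\<lambda>j. j - 1)) = nth_block \<pi>"
    by (simp add: fun_eq_iff the_inv_into_def nth_block_def l_def)
  ultimately show "bij_betw (nth_block \<pi>) {1..card \<pi>} \<pi>" by simp
  assume "k \<ge> 1"
  then have B: "the_block \<pi> 1 \<in> \<pi>" "1 \<in> the_block \<pi> 1" using the_block[OF part, of 1] by auto
  have Min1: "Min (the_block \<pi> 1) = 1"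
    using B sub[OF B(1)] finite_subset by (intro Min_eqI) auto
  have "Min (Min ` \<pi>) = 1"
  proof (rule Min_eqI)
    show "1 \<in> Min ` \<pi>" using B(1) Min1 by (metis image_eqI)
    show "1 \<le> y" if "y \<in> Min ` \<pi>" for y using that Min sub by force
  qed (use fpi in simp)
  moreover have "l ! 0 = Min (Min ` \<pi>)"
  proof -
    have "finite (Min ` \<pi>)" "Min ` \<pi> \<noteq> {}" using B(1) fpi by blast+
    then show ?thesis unfolding l_def by (subst sorted_list_of_set_nonempty) simp_all
  qed
  ultimately have "nth_block \<pi> 1 = (THE B. B \<in> \<pi> \<and> Min B = 1)"
    by (simp add: nth_block_def l_def)
  also have "\<dots> = the_block \<pi> 1"
  proof (rule the_equality)
    show "the_block \<pi> 1 \<in> \<pi> \<and> Min (the_block \<pi> 1) = 1" using B Min1 by simp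
    show "C = the_block \<pi> 1" if "C \<in> \<pi> \<and> Min C = 1" for C
      using inj_onD[OF inj, of C "the_block \<pi> 1"] that B Min1 by simp
  qed
  finally show "1 \<in> nth_block \<pi> 1" using B by simp
qed

lemma prod_nth_block:
  assumes "partition_on {1..k} \<pi>" "k \<ge> 1"
  shows "c (card (nth_block \<pi> 1)) * (\<Prod>j=2..card \<pi>. e (card (nth_block \<pi> j))) =
         block_weight (\<lambda>n. c (Suc n)) (\<lambda>n. e (Suc n)) 1 \<pi>"
proof -
  note bij = nth_block_bij[OF assms(1)]
  have fpi: "finite \<pi>" using finite_elements[OF _ assms(1)] by simp
  have pos: "Suc (card B - 1) = card B" if "B \<in> \<pi>" for B
  proof -
    have "B \<subseteq> {1..k}" "B \<noteq> {}"
      using that partition_onD1[OF assms(1)] partition_onD3[OF assms(1)] by blast+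
    moreover from this have "finite B" using finite_subset by blast
    ultimately have "finite B" "B \<noteq> {}" by auto
    then show ?thesis by (simp add: card_gt_0_iff)
  qed
  have "\<pi> \<noteq> {}" using partition_onD1[OF assms(1)] assms(2) by auto
  then have card: "card \<pi> \<ge> 1" using fpi by (simp add: Suc_leI card_gt_0_iff)
  have "block_weight (\<lambda>n. c (Suc n)) (\<lambda>n. e (Suc n)) 1 \<pi> =
    (\<Prod>B\<in>\<pi>. if 1 \<in> B then c (card B) else e (card B))"
    unfolding block_weight_def using pos by (intro prod.cong) auto
  also have "\<dots> = (\<Prod>j=1..card \<pi>. if 1 \<in> nth_block \<pi> j then c (card (nth_block \<pi> j)) else e (card (nth_block \<pi> j)))"
    using prod.reindex_bij_betw[OF bij(1), symmetric] .
  also have "{1..card \<pi>} = insert 1 {2..card \<pi>}" using card by auto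
  also have "(\<Prod>j\<in>\<dots>. if 1 \<in> nth_block \<pi> j then c (card (nth_block \<pi> j)) else e (card (nth_block \<pi> j))) =
     c (card (nth_block \<pi> 1)) * (\<Prod>j=2..card \<pi>. if 1 \<in> nth_block \<pi> j then c (card (nth_block \<pi> j)) else e (card (nth_block \<pi> j)))"
    using bij(2)[OF assms(2)] by (subst prod.insert) auto
  also have "(\<Prod>j=2..card \<pi>. if 1 \<in> nth_block \<pi> j then c (card (nth_block \<pi> j)) else e (card (nth_block \<pi> j))) =
    (\<Prod>j=2..card \<pi>. e (card (nth_block \<pi> j)))"
  proof (rule prod.cong[OF refl])
    fix j assume j: "j \<in> {2..card \<pi>}"
    have "1 \<notin> nth_block \<pi> j"
    proof
      assume "1 \<in> nth_block \<pi> j"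
      moreover have "nth_block \<pi> j \<in> \<pi>" "nth_block \<pi> 1 \<in> \<pi>"
        using j card bij(1) by (auto simp: bij_betw_def)
      ultimately have "nth_block \<pi> j = nth_block \<pi> 1"
        using bij(2)[OF assms(2)] partition_on_unique[OF assms(1)] by blast
      then have "j = 1" using inj_onD[OF bij_betw_imp_inj_on[OF bij(1)], of j 1] j card by simp
      then show False using j by simp
    qed
    then show "(if 1 \<in> nth_block \<pi> j then c (card (nth_block \<pi> j)) else e (card (nth_block \<pi> j))) =
      e (card (nth_block \<pi> j))" by simp
  qed
  finally show ?thesis by simp
qed

lemma sum_NC_first_block:
  fixes c e :: "nat \<Rightarrow> 'a::comm_semiring_1"
  shows "(\<Sum>\<pi>\<in>NC (k + 1). c (card (nth_block \<pi> 1)) * (\<Prod>j=2..card \<pi>. e (card (nth_block \<pi> j)))) =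
    (lukasiewicz_step (\<lambda>n. e (Suc n)) ^^ k) (\<lambda>n. c (Suc n)) 0"
proof -
  have "(\<Sum>\<pi>\<in>NC (k + 1). c (card (nth_block \<pi> 1)) * (\<Prod>j=2..card \<pi>. e (card (nth_block \<pi> j)))) =
    (\<Sum>\<pi>\<in>nc_partitions {1..1 + k}. block_weight (\<lambda>n. c (Suc n)) (\<lambda>n. e (Suc n)) 1 \<pi>)"
    unfolding NC_eq_nc_partitions
    by (intro sum.cong prod_nth_block[of "k + 1"]) (auto simp: nc_partitions_def)
  then show ?thesis by (simp only: sum_block_weight)
qed

text \<open>From the series 1 the first step produces the series with coefficients e (n + 1) itself,
  so that k steps from 1 are k - 1 steps in which the first block has the same weights as the
  others. This accounts for the shift between NC(\<lambda>_1 + 1) and NC(\<lambda>_i).\<close>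

lemma sum_NC:
  fixes e :: "nat \<Rightarrow> 'a::comm_semiring_1"
  assumes "k \<ge> 1"
  shows "(\<Sum>\<pi>\<in>NC k. \<Prod>j=1..card \<pi>. e (card (nth_block \<pi> j))) =
    (lukasiewicz_step (\<lambda>n. e (Suc n)) ^^ k) (\<lambda>n. if n = 0 then 1 else 0) 0"
proof -
  obtain l where l: "k = l + 1" using assms by (metis add.commute le_Suc_ex)
  have "(\<Sum>\<pi>\<in>NC k. \<Prod>j=1..card \<pi>. e (card (nth_block \<pi> j))) =
    (\<Sum>\<pi>\<in>NC k. e (card (nth_block \<pi> 1)) * (\<Prod>j=2..card \<pi>. e (card (nth_block \<pi> j))))"
  proof (rule sum.cong[OF refl])
    fix \<pi> assume "\<pi> \<in> NC k"
    then have part: "partition_on {1..k} \<pi>" by (simp add: NC_def)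
    then have "finite \<pi>" "\<pi> \<noteq> {}" using finite_elements[OF _ part] partition_onD1[OF part] assms by auto
    then have "{1..card \<pi>} = insert 1 {2..card \<pi>}" by (auto simp: Suc_le_eq card_gt_0_iff)
    then show "(\<Prod>j=1..card \<pi>. e (card (nth_block \<pi> j))) =
      e (card (nth_block \<pi> 1)) * (\<Prod>j=2..card \<pi>. e (card (nth_block \<pi> j)))" by simp
  qed
  also have "\<dots> = (lukasiewicz_step (\<lambda>n. e (Suc n)) ^^ l) (\<lambda>n. e (Suc n)) 0"
    unfolding l by (rule sum_NC_first_block)
  also have "\<dots> = (lukasiewicz_step (\<lambda>n. e (Suc n)) ^^ k) (\<lambda>n. if n = 0 then 1 else 0) 0"
  proof -
    have "(\<Sum>p\<le>n. e (Suc p) * (if n - p = 0 then 1 else 0)) = (\<Sum>p\<le>n. if p = n then e (Suc p) else 0)" for n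
      by (intro sum.cong) auto
    then have "lukasiewicz_step (\<lambda>n. e (Suc n)) (\<lambda>n. if n = 0 then 1 else 0) = (\<lambda>n. e (Suc n))"
      by (simp add: lukasiewicz_step_def fun_eq_iff)
    then show ?thesis by (simp add: l funpow_swap1)
  qed
  finally show ?thesis .
qed

section \<open>The specialization at minus one variable\<close>

definition compositions :: "nat \<Rightarrow> nat list set" where
  "compositions n = {\<alpha>. sum_list \<alpha> = n \<and> (\<forall>p\<in>set \<alpha>. 0 < p)}"

text \<open>The coefficient of z^n after specializing at minus one variable. A partition \<nu> has
  P(\<nu>) orderings, so running over compositions supplies the factor P(\<nu>).\<close>

definition alt_sum :: "nat \<Rightarrow> (nat list \<Rightarrow> complex) \<Rightarrow> complex" where
  "alt_sum n F = (\<Sum>\<alpha>\<in>compositions n. (-1) ^ length \<alpha> * F \<alpha>)"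

text \<open>These are the coefficient functions of quasisymmetric series: variables that do not
  occur may be dropped from the list of exponents.\<close>

definition zero_insensitive :: "(nat list \<Rightarrow> complex) \<Rightarrow> bool" where
  "zero_insensitive F \<longleftrightarrow> (\<forall>\<alpha> \<beta>. F (\<alpha> @ 0 # \<beta>) = F (\<alpha> @ \<beta>))"

lemma compositions_0: "compositions 0 = {[]}"
proof -
  have "\<alpha> \<in> compositions 0 \<longleftrightarrow> \<alpha> = []" for \<alpha>
    by (cases \<alpha>) (auto simp: compositions_def)
  then show ?thesis by blast
qed

lemma compositions_pos:
  assumes "n > 0"
  shows "compositions n = (\<Union>a\<in>{1..n}. (#) a ` compositions (n - a))"
proof (intro equalityI subsetI)
  fix \<alpha> assume \<alpha>: "\<alpha> \<in> compositions n"
  then obtain a \<beta> where eq: "\<alpha> = a # \<beta>" using assms by (cases \<alpha>) (auto simp: compositions_def)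
  then have "a \<in> {1..n}" "\<beta> \<in> compositions (n - a)" using \<alpha> by (auto simp: compositions_def)
  then show "\<alpha> \<in> (\<Union>a\<in>{1..n}. (#) a ` compositions (n - a))" using eq by blast
qed (auto simp: compositions_def)

lemma finite_compositions: "finite (compositions n)"
proof (induction n rule: less_induct)
  case (less n)
  then show ?case by (cases "n = 0") (auto simp: compositions_0 compositions_pos)
qed

lemma alt_sum_0: "alt_sum 0 F = F []"
  by (simp add: alt_sum_def compositions_0)

text \<open>Splitting off the first part flips the sign. The sum over a \<ge> 1 returns later, with
  a = d + 1, as the limit of the operators \<open>C_op\<close>.\<close>

lemma alt_sum_pos:
  assumes "n > 0"
  shows "alt_sum n F = - (\<Sum>a=1..n. alt_sum (n - a) (\<lambda>\<alpha>. F (a # \<alpha>)))"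
proof -
  have "alt_sum n F = (\<Sum>a=1..n. \<Sum>\<alpha>\<in>(#) a ` compositions (n - a). (-1) ^ length \<alpha> * F \<alpha>)"
    unfolding alt_sum_def compositions_pos[OF assms]
    by (intro sum.UNION_disjoint) (auto simp: finite_compositions)
  also have "\<dots> = (\<Sum>a=1..n. - alt_sum (n - a) (\<lambda>\<alpha>. F (a # \<alpha>)))"
    by (simp add: alt_sum_def sum.reindex sum_negf)
  finally show ?thesis by (simp add: sum_negf)
qed

lemma zero_insensitive_Cons_0: "zero_insensitive F \<Longrightarrow> F (0 # \<alpha>) = F \<alpha>"
  unfolding zero_insensitive_def by (metis append_Nil)

lemma zero_insensitive_Cons: "zero_insensitive F \<Longrightarrow> zero_insensitive (\<lambda>\<alpha>. F (a # \<alpha>))"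
  unfolding zero_insensitive_def by (metis append_Cons)

text \<open>Specialization at z together with minus z: the alphabets cancel. In terms of
  compositions, the summand a = 0 is \<open>alt_sum n F\<close> and the others add up to its
  negative.\<close>

lemma alt_sum_telescope:
  assumes "zero_insensitive F"
  shows "(\<Sum>a\<le>n. alt_sum (n - a) (\<lambda>\<alpha>. F (a # \<alpha>))) = (if n = 0 then F [] else 0)"
proof (cases "n = 0")
  case False
  have "{..n} = insert 0 {1..n}" by auto
  then show ?thesis using False by (simp add: zero_insensitive_Cons_0[OF assms] alt_sum_pos)
qed (simp add: alt_sum_0 zero_insensitive_Cons_0[OF assms])

text \<open>The coefficient of a product at the exponents \<alpha>. The two factors are read at
  lists that contain zeros even if \<alpha> has none, which is where \<open>zero_insensitive\<close>
  enters.\<close>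

fun convolve :: "(nat list \<Rightarrow> complex) \<Rightarrow> (nat list \<Rightarrow> complex) \<Rightarrow> nat list \<Rightarrow> complex" where
  "convolve F G [] = F [] * G []"
| "convolve F G (a # \<alpha>) = (\<Sum>b\<le>a. convolve (\<lambda>\<beta>. F (b # \<beta>)) (\<lambda>\<beta>. G ((a - b) # \<beta>)) \<alpha>)"

lemma alt_sum_sum: "finite I \<Longrightarrow> alt_sum n (\<lambda>\<alpha>. \<Sum>i\<in>I. F i \<alpha>) = (\<Sum>i\<in>I. alt_sum n (F i))"
  unfolding alt_sum_def sum_distrib_left by (rule sum.swap)

text \<open>Both sides of \<open>alt_sum_telescope\<close> for the product are compared: the terms with \<open>a > 0\<close> are
  known by induction, which determines the one with \<open>a = 0\<close>.\<close>

lemma alt_sum_convolve: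
  assumes "zero_insensitive F" "zero_insensitive G"
  shows "alt_sum n (convolve F G) = (\<Sum>p\<le>n. alt_sum p F * alt_sum (n - p) G)"
  using assms
proof (induction n arbitrary: F G rule: less_induct)
  case (less n)
  define f where "f b p = alt_sum p (\<lambda>\<beta>. F (b # \<beta>))" for b p
  define g where "g b p = alt_sum p (\<lambda>\<beta>. G (b # \<beta>))" for b p
  have f0: "f 0 p = alt_sum p F" and g0: "g 0 p = alt_sum p G" for p
    by (simp_all add: f_def g_def zero_insensitive_Cons_0 less.prems)
  have split: "alt_sum m (\<lambda>\<alpha>. convolve F G (a # \<alpha>)) =
      (\<Sum>b\<le>a. alt_sum m (convolve (\<lambda>\<beta>. F (b # \<beta>)) (\<lambda>\<beta>. G ((a - b) # \<beta>))))" for m a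
    by (simp add: alt_sum_sum)
  show ?case
  proof (cases "n = 0")
    case True
    then show ?thesis by (simp add: alt_sum_0)
  next
    case False
    have *: "alt_sum (n - a) (\<lambda>\<alpha>. convolve F G (a # \<alpha>)) =
        (\<Sum>b\<le>a. \<Sum>p\<le>n - a. f b p * g (a - b) (n - a - p))" if "a \<in> {1..n}" for a
      unfolding split f_def g_def using that less.prems
      by (intro sum.cong less.IH zero_insensitive_Cons refl) auto
    have "alt_sum n (convolve F G) = - (\<Sum>a=1..n. \<Sum>b\<le>a. \<Sum>p\<le>n - a. f b p * g (a - b) (n - a - p))"
      using False * by (simp add: alt_sum_pos)
    also have "\<dots> = (\<Sum>p\<le>n. f 0 p * g 0 (n - p)) - (\<Sum>a\<le>n. \<Sum>b\<le>a. \<Sum>p\<le>n - a. f b p * g (a - b) (n - a - p))"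
    proof -
      have "{..n} = insert 0 {1..n}" by auto
      then show ?thesis by simp
    qed
    also have "(\<Sum>a\<le>n. \<Sum>b\<le>a. \<Sum>p\<le>n - a. f b p * g (a - b) (n - a - p)) =
      (\<Sum>r\<le>n. (\<Sum>b\<le>r. f b (r - b)) * (\<Sum>c\<le>n - r. g c (n - r - c)))"
    proof -
      have "(\<Sum>a\<le>n. \<Sum>b\<le>a. \<Sum>p\<le>n - a. f b p * g (a - b) (n - a - p)) =
        (\<Sum>(a, b, p)\<in>(SIGMA a:{..n}. {..a} \<times> {..n - a}). f b p * g (a - b) (n - a - p))"
        by (simp add: sum.Sigma sum.cartesian_product)
      also have "\<dots> = (\<Sum>(r, b, c)\<in>(SIGMA r:{..n}. {..r} \<times> {..n - r}). f b (r - b) * g c (n - r - c))"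
        by (rule sum.reindex_bij_witness[where i = "\<lambda>(r, b, c). (b + c, b, r - b)"
              and j = "\<lambda>(a, b, p). (b + p, b, a - b)"]) (auto simp: add.commute)
      also have "\<dots> = (\<Sum>r\<le>n. (\<Sum>b\<le>r. f b (r - b)) * (\<Sum>c\<le>n - r. g c (n - r - c)))"
        by (simp add: sum.Sigma sum.cartesian_product sum_product)
      finally show ?thesis .
    qed
    \<comment> \<open>As n > 0, one of r and n - r is positive, and the corresponding factor
      vanishes by telescoping.\<close>
    also have "\<dots> = 0"
      using False alt_sum_telescope[OF less.prems(1)] alt_sum_telescope[OF less.prems(2)]
      by (intro sum.neutral) (auto simp: f_def g_def)
    finally show ?thesis by (simp add: f0 g0)
  qed
qed

text \<open>In the limit, \<open>s d \<alpha>\<close> is the coefficient of the monomial with exponent \<open>d\<close> of the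
  distinguished variable and exponents \<open>\<alpha>\<close>, possibly with zeros, of the others.\<close>

definition moment_seq :: "complex \<Rightarrow> (nat \<Rightarrow> nat list \<Rightarrow> complex) \<Rightarrow> nat \<Rightarrow> complex" where
  "moment_seq \<theta> s n = \<theta> ^ n * (\<Sum>d\<le>n. alt_sum (n - d) (s d))"

definition limit_times ::
    "(nat \<Rightarrow> nat list \<Rightarrow> complex) \<Rightarrow> (nat \<Rightarrow> nat list \<Rightarrow> complex) \<Rightarrow> nat \<Rightarrow> nat list \<Rightarrow> complex" where
  "limit_times f g d \<alpha> = (\<Sum>b\<le>d. convolve (f b) (g (d - b)) \<alpha>)"

text \<open>The operator \<open>\<theta> D + f\<close> acting on coefficients instead of basis
  elements: in the average over j almost every x_j is absent from the monomial, and there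
  \<open>C_op\<close> reads the coefficient with an additional exponent d + 1.\<close>

definition limit_Q :: "complex \<Rightarrow> (nat \<Rightarrow> nat list \<Rightarrow> complex) \<Rightarrow>
    (nat \<Rightarrow> nat list \<Rightarrow> complex) \<Rightarrow> nat \<Rightarrow> nat list \<Rightarrow> complex" where
  "limit_Q \<theta> f g d \<alpha> = \<theta> * (g (Suc d) \<alpha> - g 0 (Suc d # \<alpha>)) + limit_times f g d \<alpha>"

section \<open>The specialization of products and of the limit operator\<close>

lemma alt_sum_linear:
  "alt_sum n (\<lambda>\<alpha>. c * F \<alpha>) = c * alt_sum n F"
  "alt_sum n (\<lambda>\<alpha>. F \<alpha> + G \<alpha>) = alt_sum n F + alt_sum n G"
  "alt_sum n (\<lambda>\<alpha>. F \<alpha> - G \<alpha>) = alt_sum n F - alt_sum n G"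
  unfolding alt_sum_def
  by (simp add: sum_distrib_left mult.left_commute, simp only: distrib_left sum.distrib,
      simp only: right_diff_distrib sum_subtractf)

lemma moment_seq_limit_times:
  assumes "\<And>d. zero_insensitive (f d)" "\<And>d. zero_insensitive (g d)"
  shows "moment_seq \<theta> (limit_times f g) n = (\<Sum>p\<le>n. moment_seq \<theta> f p * moment_seq \<theta> g (n - p))"
proof -
  have "(\<Sum>d\<le>n. alt_sum (n - d) (limit_times f g d)) =
    (\<Sum>d\<le>n. \<Sum>b\<le>d. \<Sum>p\<le>n - d. alt_sum p (f b) * alt_sum (n - d - p) (g (d - b)))"
    unfolding limit_times_def by (simp add: alt_sum_sum alt_sum_convolve assms)
  also have "\<dots> = (\<Sum>(d, b, p)\<in>(SIGMA d:{..n}. {..d} \<times> {..n - d}). alt_sum p (f b) * alt_sum (n - d - p) (g (d - b)))"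
    by (simp add: sum.Sigma sum.cartesian_product)
  \<comment> \<open>Regrouping by the degree r = b + p that goes to \<open>f\<close>; b and c = d -
    b are the exponents of the distinguished variable in the two factors.\<close>
  also have "\<dots> = (\<Sum>(r, b, c)\<in>(SIGMA r:{..n}. {..r} \<times> {..n - r}). alt_sum (r - b) (f b) * alt_sum (n - r - c) (g c))"
    by (rule sum.reindex_bij_witness[where i = "\<lambda>(r, b, c). (b + c, b, r - b)"
          and j = "\<lambda>(a, b, p). (b + p, b, a - b)"]) (auto simp: add.commute)
  also have "\<dots> = (\<Sum>r\<le>n. (\<Sum>b\<le>r. alt_sum (r - b) (f b)) * (\<Sum>c\<le>n - r. alt_sum (n - r - c) (g c)))"
    by (simp add: sum.Sigma sum.cartesian_product sum_product)
  finally have "moment_seq \<theta> (limit_times f g) n =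
    (\<Sum>r\<le>n. \<theta> ^ n * ((\<Sum>b\<le>r. alt_sum (r - b) (f b)) * (\<Sum>c\<le>n - r. alt_sum (n - r - c) (g c))))"
    by (simp add: moment_seq_def sum_distrib_left)
  also have "\<dots> = (\<Sum>p\<le>n. moment_seq \<theta> f p * moment_seq \<theta> g (n - p))"
  proof (rule sum.cong[OF refl])
    fix r assume "r \<in> {..n}"
    then have "\<theta> ^ n = \<theta> ^ r * \<theta> ^ (n - r)" by (simp flip: power_add)
    then show "\<theta> ^ n * ((\<Sum>b\<le>r. alt_sum (r - b) (f b)) * (\<Sum>c\<le>n - r. alt_sum (n - r - c) (g c))) =
      moment_seq \<theta> f r * moment_seq \<theta> g (n - r)"
      by (simp add: moment_seq_def)
  qed
  finally show ?thesis .
qed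

text \<open>In degree n + 1 of \<open>g\<close>, the terms \<open>g (Suc d)\<close> supply the
  exponents 1, ..., n + 1 of the distinguished variable. The terms
  \<open>g 0 (Suc d # \<alpha>)\<close> add up, by splitting off first parts, to minus the missing
  exponent 0. The factor \<theta> completes \<theta>^n to \<theta>^(n + 1).\<close>

lemma moment_seq_limit_Q:
  assumes "\<And>d. zero_insensitive (f d)" "\<And>d. zero_insensitive (g d)"
  shows "moment_seq \<theta> (limit_Q \<theta> f g) n =
    moment_seq \<theta> g (Suc n) + (\<Sum>p\<le>n. moment_seq \<theta> f p * moment_seq \<theta> g (n - p))"
proof -
  define D where "D d \<alpha> = g (Suc d) \<alpha> - g 0 (Suc d # \<alpha>)" for d \<alpha>
  have "(\<Sum>d\<le>n. alt_sum (n - d) (\<lambda>\<alpha>. g 0 (Suc d # \<alpha>))) =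
      (\<Sum>a=1..Suc n. alt_sum (Suc n - a) (\<lambda>\<alpha>. g 0 (a # \<alpha>)))"
    by (rule sum.reindex_bij_witness[where i = "\<lambda>a. a - 1" and j = Suc]) auto
  then have 1: "(\<Sum>d\<le>n. alt_sum (n - d) (\<lambda>\<alpha>. g 0 (Suc d # \<alpha>))) = - alt_sum (Suc n) (g 0)"
    using alt_sum_pos[OF zero_less_Suc, of n "g 0"] by (simp only: minus_minus)
  have 2: "(\<Sum>d\<le>Suc n. alt_sum (Suc n - d) (g d)) =
    alt_sum (Suc n) (g 0) + (\<Sum>d\<le>n. alt_sum (n - d) (g (Suc d)))"
    using sum.atMost_Suc_shift[of "\<lambda>d. alt_sum (Suc n - d) (g d)" n] by (simp only: diff_zero diff_Suc_Suc)
  have "alt_sum m (D d) = alt_sum m (g (Suc d)) - alt_sum m (\<lambda>\<alpha>. g 0 (Suc d # \<alpha>))" for m d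
    unfolding D_def by (rule alt_sum_linear(3))
  then have 3: "(\<Sum>d\<le>n. alt_sum (n - d) (D d)) = (\<Sum>d\<le>Suc n. alt_sum (Suc n - d) (g d))"
    unfolding 2 by (simp only: sum_subtractf 1) (simp only: minus_minus diff_minus_eq_add add.commute)
  have Q: "limit_Q \<theta> f g d = (\<lambda>\<alpha>. \<theta> * D d \<alpha> + limit_times f g d \<alpha>)" for d
    by (simp add: fun_eq_iff limit_Q_def D_def)
  have "alt_sum m (limit_Q \<theta> f g d) = \<theta> * alt_sum m (D d) + alt_sum m (limit_times f g d)" for m d
    unfolding Q alt_sum_linear(2) alt_sum_linear(1) ..
  then have "moment_seq \<theta> (limit_Q \<theta> f g) n =
     \<theta> ^ n * (\<theta> * (\<Sum>d\<le>n. alt_sum (n - d) (D d))) + moment_seq \<theta> (limit_times f g) n"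
    unfolding moment_seq_def by (simp only: sum.distrib distrib_left sum_distrib_left)
  then show ?thesis
    unfolding 3 moment_seq_limit_times[OF assms] by (simp only: moment_seq_def power_Suc2 mult.assoc)
qed

text \<open>Once the distinguished variable is 0, the next one takes its role and its exponent d is
  the head of the list. By the remaining symmetry the specialization is at z - z.\<close>

lemma moment_seq_set_zero:
  assumes "zero_insensitive (q 0)"
  shows "moment_seq \<theta> (\<lambda>d \<alpha>. q 0 (d # \<alpha>)) n = (if n = 0 then q 0 [] else 0)"
  using alt_sum_telescope[OF assms, of n] by (simp add: moment_seq_def)

text \<open>\<open>s\<close> is given on partitions only; \<open>\<alpha>\<close> may be unsorted and contain zeros.\<close>

definition partition_of :: "nat list \<Rightarrow> nat list" where
  "partition_of \<alpha> = rev (sort (filter (\<lambda>p. 0 < p) \<alpha>))"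

lemma mset_partition_of: "mset (partition_of \<alpha>) = filter_mset (\<lambda>p. 0 < p) (mset \<alpha>)"
  by (simp add: partition_of_def)

lemma partition_of_in_partitions: "partition_of \<alpha> \<in> partitions"
  by (auto simp: partition_of_def partitions_def sorted_wrt_rev)

lemma partition_of_eqI: "\<nu> \<in> partitions \<Longrightarrow> mset \<nu> = filter_mset (\<lambda>p. 0 < p) (mset \<alpha>) \<Longrightarrow> partition_of \<alpha> = \<nu>"
proof -
  assume \<nu>: "\<nu> \<in> partitions" and eq: "mset \<nu> = filter_mset (\<lambda>p. 0 < p) (mset \<alpha>)"
  have "sorted (rev \<nu>)" using \<nu> by (simp add: partitions_def sorted_wrt_rev)
  moreover have "mset (rev \<nu>) = mset (filter (\<lambda>p. 0 < p) \<alpha>)" using eq by simp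
  ultimately have "sort (filter (\<lambda>p. 0 < p) \<alpha>) = rev \<nu>" by (intro properties_for_sort)
  then show ?thesis by (simp add: partition_of_def)
qed

text \<open>The compositions with the same parts \<nu> are the distinct permutations of \<nu>: there
  are P(\<nu>) of them, all with the same sign and the same coefficient.\<close>

lemma free_cumulant_eq_moment_seq:
  "free_cumulant \<theta> s (Suc n) = moment_seq \<theta> (\<lambda>d \<alpha>. s d (partition_of \<alpha>)) n"
proof -
  have pos: "filter_mset (\<lambda>p. 0 < p) (mset \<nu>) = mset \<nu>" if "\<forall>p\<in>set \<nu>. 0 < p" for \<nu> :: "nat list"
  proof -
    have "filter (\<lambda>p. 0 < p) \<nu> = \<nu>" using that by (intro filter_True)
    then have "mset (filter (\<lambda>p. 0 < p) \<nu>) = mset \<nu>" by (rule arg_cong)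
    then show ?thesis unfolding mset_filter .
  qed
  define P where "P m = {\<nu>\<in>partitions. sum_list \<nu> = m}" for m
  have P: "partition_of ` compositions m = P m" for m
  proof (intro equalityI subsetI)
    fix \<nu> assume "\<nu> \<in> P m"
    then have "\<nu> \<in> compositions m" "\<nu> \<in> partitions" by (auto simp: P_def compositions_def partitions_def)
    moreover from this have "partition_of \<nu> = \<nu>"
      using pos[of \<nu>] by (intro partition_of_eqI) (auto simp: partitions_def)
    ultimately show "\<nu> \<in> partition_of ` compositions m" by (metis image_eqI)
  next
    fix \<nu> assume "\<nu> \<in> partition_of ` compositions m"
    then obtain \<alpha> where \<alpha>: "\<alpha> \<in> compositions m" "\<nu> = partition_of \<alpha>" by auto
    then have "mset \<nu> = mset \<alpha>" by (simp add: mset_partition_of compositions_def pos)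
    then have "sum_list \<nu> = sum_list \<alpha>" by (metis sum_mset_sum_list)
    then show "\<nu> \<in> P m" using \<alpha> partition_of_in_partitions by (simp add: P_def compositions_def)
  qed
  then have fin: "finite (P m)" for m using finite_compositions by (metis finite_imageI)
  have "alt_sum m (\<lambda>\<alpha>. s d (partition_of \<alpha>)) =
    (\<Sum>\<nu>\<in>P m. (-1) ^ length \<nu> * of_nat (num_perms \<nu>) * s d \<nu>)" for m d
  proof -
    have "alt_sum m (\<lambda>\<alpha>. s d (partition_of \<alpha>)) =
      (\<Sum>\<nu>\<in>P m. \<Sum>\<alpha>\<in>{\<alpha>\<in>compositions m. partition_of \<alpha> = \<nu>}. (-1) ^ length \<alpha> * s d (partition_of \<alpha>))"
      unfolding alt_sum_def using P fin finite_compositions by (intro sum.group[symmetric]) auto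
    also have "\<dots> = (\<Sum>\<nu>\<in>P m. (-1) ^ length \<nu> * of_nat (num_perms \<nu>) * s d \<nu>)"
    proof (rule sum.cong[OF refl])
      fix \<nu> assume \<nu>: "\<nu> \<in> P m"
      have "{\<alpha>\<in>compositions m. partition_of \<alpha> = \<nu>} = permutations_of_multiset (mset \<nu>)"
      proof (intro equalityI subsetI)
        fix \<alpha> assume "\<alpha> \<in> {\<alpha>\<in>compositions m. partition_of \<alpha> = \<nu>}"
        then show "\<alpha> \<in> permutations_of_multiset (mset \<nu>)"
          using mset_partition_of[of \<alpha>]
          by (auto simp: permutations_of_multiset_def compositions_def pos)
      next
        fix \<alpha> assume "\<alpha> \<in> permutations_of_multiset (mset \<nu>)"
        then have *: "mset \<alpha> = mset \<nu>" by (simp add: permutations_of_multiset_def)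
        then have "sum_list \<alpha> = sum_list \<nu>" "set \<alpha> = set \<nu>"
          by (metis sum_mset_sum_list, metis set_mset_mset)
        then have "\<alpha> \<in> compositions m" using \<nu> by (auto simp: compositions_def P_def partitions_def)
        moreover from this have "partition_of \<alpha> = \<nu>"
          using \<nu> * pos[of \<nu>] by (intro partition_of_eqI) (auto simp: P_def partitions_def)
        ultimately show "\<alpha> \<in> {\<alpha>\<in>compositions m. partition_of \<alpha> = \<nu>}" by simp
      qed
      moreover have "(-1) ^ length \<alpha> * s d (partition_of \<alpha>) = (-1) ^ length \<nu> * s d \<nu>"
        if "\<alpha> \<in> {\<alpha>\<in>compositions m. partition_of \<alpha> = \<nu>}" "\<alpha> \<in> permutations_of_multiset (mset \<nu>)" for \<alpha>
        using that by (auto simp: permutations_of_multiset_def dest!: mset_eq_length)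
      ultimately have "(\<Sum>\<alpha>\<in>{\<alpha>\<in>compositions m. partition_of \<alpha> = \<nu>}. (-1) ^ length \<alpha> * s d (partition_of \<alpha>)) =
        (\<Sum>\<alpha>\<in>permutations_of_multiset (mset \<nu>). (-1) ^ length \<nu> * s d \<nu>)"
        by (intro sum.cong) auto
      then show "(\<Sum>\<alpha>\<in>{\<alpha>\<in>compositions m. partition_of \<alpha> = \<nu>}. (-1) ^ length \<alpha> * s d (partition_of \<alpha>)) =
        (-1) ^ length \<nu> * of_nat (num_perms \<nu>) * s d \<nu>"
        by (simp add: num_perms_def)
    qed
    finally show ?thesis .
  qed
  then have "moment_seq \<theta> (\<lambda>d \<alpha>. s d (partition_of \<alpha>)) n =
    \<theta> ^ n * (\<Sum>(d, \<nu>)\<in>(SIGMA d:{..n}. P (n - d)). (-1) ^ length \<nu> * of_nat (num_perms \<nu>) * s d \<nu>)"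
    using fin by (simp add: moment_seq_def sum.Sigma)
  also have "(SIGMA d:{..n}. P (n - d)) = {(d, \<nu>). \<nu> \<in> partitions \<and> sum_list \<nu> + d = n}"
    unfolding P_def by auto
  finally show ?thesis by (simp add: free_cumulant_def)
qed

section \<open>Monomials and coefficients\<close>

abbreviation (input) "lookup \<equiv> Poly_Mapping.lookup"
abbreviation (input) "keys \<equiv> Poly_Mapping.keys"
abbreviation (input) "single \<equiv> Poly_Mapping.single"
abbreviation (input) "update \<equiv> Poly_Mapping.update"
abbreviation (input) "map_key \<equiv> Poly_Mapping.map_key"

text \<open>A divisor of \<open>a\<close> is determined by its exponents on \<open>keys a\<close>,
  each bounded by that of \<open>a\<close>. Over an infinite index set the sum in
  \<open>times_series\<close> would be 0 by convention.\<close>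

lemma finite_monomial_decompositions:
  fixes a :: monomial
  shows "finite {(b, c). b + c = a}"
proof -
  let ?T = "PiE (keys a) (\<lambda>k. {..lookup a k})"
  let ?f = "\<lambda>b. restrict (lookup b) (keys a)"
  have le: "lookup b k \<le> lookup a k" if "b + c = a" for b c :: monomial and k
    using that by (auto simp: lookup_add)
  have 0: "lookup b k = 0" if "b + c = a" "k \<notin> keys a" for b c :: monomial and k
    using le[OF that(1), of k] that(2) by (simp add: in_keys_iff)
  have "finite {b. \<exists>c. b + c = a}"
  proof (rule inj_on_finite[of ?f _ ?T])
    show "inj_on ?f {b. \<exists>c. b + c = a}"
    proof (rule inj_onI)
      fix b b' assume b: "b \<in> {b. \<exists>c. b + c = a}" and b': "b' \<in> {b. \<exists>c. b + c = a}"
        and eq: "?f b = ?f b'"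
      show "b = b'"
      proof (rule poly_mapping_eqI)
        fix k show "lookup b k = lookup b' k"
          using fun_cong[OF eq, of k] 0[of b _ k] 0[of b' _ k] b b' by (cases "k \<in> keys a") auto
      qed
    qed
    show "?f ` {b. \<exists>c. b + c = a} \<subseteq> ?T"
    proof
      fix h assume "h \<in> ?f ` {b. \<exists>c. b + c = a}"
      then obtain b c where "h = ?f b" "b + c = a" by auto
      then show "h \<in> ?T" using le[of b c] by (auto simp: PiE_iff)
    qed
    show "finite ?T" by (intro finite_PiE) auto
  qed
  moreover have "{(b, c). b + c = a} \<subseteq> (\<lambda>b. (b, a - b)) ` {b. \<exists>c. b + c = a}"
    by (auto simp: image_iff)
  ultimately show ?thesis using finite_subset by blast
qed

text \<open>The exponent of a variable absent from \<open>a\<close> is distributed over the two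
  factors independently of the rest. One application per variable turns a product of series into
  \<open>convolve\<close>.\<close>

lemma sum_decompositions_add_single:
  fixes a :: monomial
  assumes "k \<notin> keys a"
  shows "(\<Sum>(b, c) | b + c = a + single k x. h b c) =
    (\<Sum>y\<le>x. \<Sum>(b, c) | b + c = a. h (b + single k y) (c + single k (x - y)))"
proof -
  have ak: "lookup a k = 0" using assms by (simp add: in_keys_iff)
  have cancel: "update k 0 (b + single k y) = b" if "lookup b k = 0" for b :: monomial and y
    by (rule poly_mapping_eqI) (use that in \<open>auto simp: lookup_update lookup_add lookup_single when_def\<close>)
  have restore: "update k 0 b + single k (lookup b k) = b" for b :: monomial
    by (rule poly_mapping_eqI) (auto simp: lookup_update lookup_add lookup_single when_def)
  have "(\<Sum>y\<le>x. \<Sum>(b, c) | b + c = a. h (b + single k y) (c + single k (x - y))) =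
    (\<Sum>(y, b, c)\<in>{..x} \<times> {(b, c). b + c = a}. h (b + single k y) (c + single k (x - y)))"
    by (subst sum.cartesian_product) (auto intro!: sum.cong)
  also have "\<dots> = (\<Sum>(b, c) | b + c = a + single k x. h b c)"
  proof (rule sum.reindex_bij_witness[where
        i = "\<lambda>(b, c). (lookup b k, update k 0 b, update k 0 c)" and
        j = "\<lambda>(y, b, c). (b + single k y, c + single k (x - y))"])
    fix z assume "z \<in> {..x} \<times> {(b, c). b + c = a}"
    then obtain y b c where z: "z = (y, b, c)" "y \<le> x" "b + c = a" by auto
    have "lookup b k + lookup c k = 0" using ak z(3) by (simp flip: lookup_add)
    then have 0: "lookup b k = 0" "lookup c k = 0" by auto
    show "(case case z of (y, b, c) \<Rightarrow> (b + single k y, c + single k (x - y)) of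
         (b, c) \<Rightarrow> (lookup b k, update k 0 b, update k 0 c)) = z"
      using 0 by (simp add: z(1) cancel lookup_add)
    show "(case z of (y, b, c) \<Rightarrow> (b + single k y, c + single k (x - y))) \<in> {(b, c). b + c = a + single k x}"
      using z by (auto simp: single_add[symmetric] algebra_simps)
    show "(case case z of (y, b, c) \<Rightarrow> (b + single k y, c + single k (x - y)) of (b, c) \<Rightarrow> h b c) =
         (case z of (y, b, c) \<Rightarrow> h (b + single k y) (c + single k (x - y)))"
      by (simp add: z(1))
  next
    fix z assume "z \<in> {(b, c). b + c = a + single k x}"
    then obtain b c where z: "z = (b, c)" "b + c = a + single k x" by auto
    have "lookup b k + lookup c k = x" using arg_cong[OF z(2), of "\<lambda>a. lookup a k"] ak by (simp add: lookup_add)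
    then have x: "lookup b k \<le> x" "x - lookup b k = lookup c k" by auto
    have "update k 0 b + update k 0 c = a"
    proof (rule poly_mapping_eqI)
      fix l show "lookup (update k 0 b + update k 0 c) l = lookup a l"
        using arg_cong[OF z(2), of "\<lambda>a. lookup a l"] ak
        by (cases "l = k") (auto simp: lookup_add lookup_update lookup_single when_def)
    qed
    then show "(case z of (b, c) \<Rightarrow> (lookup b k, update k 0 b, update k 0 c)) \<in> {..x} \<times> {(b, c). b + c = a}"
      using x z by simp
    show "(case case z of (b, c) \<Rightarrow> (lookup b k, update k 0 b, update k 0 c) of
         (y, b, c) \<Rightarrow> (b + single k y, c + single k (x - y))) = z"
      using x z(1) by (simp add: restore)
  qed
  finally show ?thesis by simp
qed

text \<open>The head of the list belongs to the last variable, so that adding an entry does not shift the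
  other ones.\<close>

primrec monomial_of_list :: "nat list \<Rightarrow> monomial" where
  "monomial_of_list [] = 0"
| "monomial_of_list (x # \<alpha>) = monomial_of_list \<alpha> + single (Suc (length \<alpha>)) x"

lemma keys_monomial_of_list: "keys (monomial_of_list \<alpha>) \<subseteq> {1..length \<alpha>}"
proof (induction \<alpha>)
  case (Cons x \<alpha>)
  have "keys (monomial_of_list (x # \<alpha>)) \<subseteq> keys (monomial_of_list \<alpha>) \<union> {Suc (length \<alpha>)}"
    using keys_add[of "monomial_of_list \<alpha>" "single (Suc (length \<alpha>)) x"] keys_single[of "Suc (length \<alpha>)" x]
    by (auto split: if_splits)
  then show ?case using Cons by force
qed simp

text \<open>The monomial \<open>x\<^sub>M\<^sup>d x\<^sup>\<alpha>\<close>; this reading is only valid for \<open>M > length \<alpha>\<close>.\<close>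

definition monomial_at :: "nat \<Rightarrow> nat \<Rightarrow> nat list \<Rightarrow> monomial" where
  "monomial_at M d \<alpha> = monomial_of_list \<alpha> + single M d"

lemma keys_monomial_at: "length \<alpha> < M \<Longrightarrow> keys (monomial_at M d \<alpha>) \<subseteq> {1..M}"
proof -
  assume "length \<alpha> < M"
  moreover have "keys (monomial_at M d \<alpha>) \<subseteq> keys (monomial_of_list \<alpha>) \<union> {M}"
    using keys_add[of "monomial_of_list \<alpha>" "single M d"] keys_single[of M d]
    by (auto simp: monomial_at_def split: if_splits)
  ultimately show ?thesis using keys_monomial_of_list[of \<alpha>] by force
qed

lemma lookup_monomial_at: "length \<alpha> < M \<Longrightarrow> lookup (monomial_at M d \<alpha>) M = d"
  using keys_monomial_of_list[of \<alpha>] by (force simp: monomial_at_def lookup_add in_keys_iff)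

text \<open>Together with the exponent of x_i this determines the orbit of a monomial in x_1, ...,
  x_N under the permutations of the variables other than x_i.\<close>

definition other_exponents :: "nat \<Rightarrow> monomial \<Rightarrow> nat multiset" where
  "other_exponents i a = image_mset (lookup a) (mset_set (keys a - {i}))"

lemma other_exponents_add_single:
  assumes "k \<notin> keys a"
  shows "other_exponents i (a + single k x) =
    (if k = i \<or> x = 0 then other_exponents i a else add_mset x (other_exponents i a))"
proof (cases "x = 0")
  case False
  have ak: "lookup a k = 0" using assms by (simp add: in_keys_iff)
  have K: "keys (a + single k x) = insert k (keys a)"
  proof (intro equalityI subsetI)
    fix l show "l \<in> keys (a + single k x) \<Longrightarrow> l \<in> insert k (keys a)"
      by (auto simp: in_keys_iff lookup_add lookup_single when_def split: if_splits)
    show "l \<in> insert k (keys a) \<Longrightarrow> l \<in> keys (a + single k x)"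
      using False by (auto simp: in_keys_iff lookup_add)
  qed
  have eq: "lookup (a + single k x) l = lookup a l" if "l \<in> keys a" for l
    using that assms by (auto simp: lookup_add lookup_single when_def)
  have *: "image_mset (lookup (a + single k x)) (mset_set (keys a - {i})) = other_exponents i a"
    unfolding other_exponents_def by (intro image_mset_cong eq) auto
  show ?thesis
  proof (cases "k = i")
    case True
    have "keys (a + single k x) - {i} = keys a - {i}" using K True by auto
    then show ?thesis using True * by (simp add: other_exponents_def)
  next
    case ne: False
    have "keys (a + single k x) - {i} = insert k (keys a - {i})" using K ne by auto
    then have "other_exponents i (a + single k x) = add_mset (lookup (a + single k x) k)
        (image_mset (lookup (a + single k x)) (mset_set (keys a - {i})))"
      using assms by (simp add: other_exponents_def)
    then show ?thesis using * ak ne False by (simp add: lookup_add)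
  qed
qed simp

lemma other_exponents_monomial_at:
  assumes "length \<alpha> < M"
  shows "other_exponents M (monomial_at M d \<alpha>) = filter_mset (\<lambda>p. 0 < p) (mset \<alpha>)"
proof -
  have "other_exponents M (monomial_of_list \<alpha>) = filter_mset (\<lambda>p. 0 < p) (mset \<alpha>)"
    using assms
  proof (induction \<alpha>)
    case (Cons x \<alpha>)
    have "Suc (length \<alpha>) \<notin> keys (monomial_of_list \<alpha>)" using keys_monomial_of_list[of \<alpha>] by force
    then show ?case using Cons by (simp add: other_exponents_add_single)
  qed (simp add: other_exponents_def)
  moreover have "M \<notin> keys (monomial_of_list \<alpha>)" using keys_monomial_of_list[of \<alpha>] assms by force
  ultimately show ?thesis by (simp add: monomial_at_def other_exponents_add_single)
qed

section \<open>Orbits of monomials\<close>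

lemma lookup_map_key_permutes: "\<sigma> permutes S \<Longrightarrow> lookup (map_key \<sigma> a) k = lookup a (\<sigma> k)"
  by (simp add: map_key.rep_eq permutes_inj)

text \<open>Padding with zeros recovers all exponents on \<open>S\<close> from the nonzero ones, so
  that equal multisets of nonzero exponents yield a permutation of \<open>S\<close>.\<close>

lemma image_mset_lookup:
  assumes "finite S" "keys a - {i} \<subseteq> S" "i \<notin> S"
  shows "image_mset (lookup a) (mset_set S) =
    other_exponents i a + replicate_mset (card S - size (other_exponents i a)) 0"
proof -
  have fin: "finite (keys a - {i})" by simp
  have "mset_set S = mset_set (keys a - {i}) + mset_set (S - (keys a - {i}))"
    using mset_set_Union[of "keys a - {i}" "S - (keys a - {i})"] assms
    by (simp add: Un_absorb1)
  moreover have "image_mset (lookup a) (mset_set (S - (keys a - {i}))) =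
      image_mset (\<lambda>_. 0) (mset_set (S - (keys a - {i})))"
    using assms by (intro image_mset_cong) (auto simp: in_keys_iff)
  moreover have "card (S - (keys a - {i})) = card S - size (other_exponents i a)"
    using card_Diff_subset[OF fin assms(2)] by (simp add: other_exponents_def)
  ultimately show ?thesis by (simp add: other_exponents_def image_mset_const_eq)
qed

lemma sym_series_eqI:
  assumes "F \<in> sym_series i N" "keys a \<subseteq> {1..N}" "keys b \<subseteq> {1..N}" "lookup a i = lookup b i"
    and "other_exponents i a = other_exponents i b"
  shows "F a = F b"
proof -
  let ?S = "{1..N} - {i}"
  have "image_mset (lookup a) (mset_set ?S) = image_mset (lookup b) (mset_set ?S)"
    using assms by (subst (1 2) image_mset_lookup[where i = i]) auto
  then obtain \<sigma> where \<sigma>: "\<sigma> permutes ?S" "\<forall>k\<in>?S. lookup a k = lookup b (\<sigma> k)"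
    using image_mset_eq_implies_permutes[of ?S "lookup a" "lookup b"] by auto
  have "map_key \<sigma> b = a"
  proof (rule poly_mapping_eqI)
    fix k
    consider "k \<in> ?S" | "k = i" | "k \<notin> {1..N}" by blast
    then have "lookup b (\<sigma> k) = lookup a k"
    proof cases
      case 2
      then have "\<sigma> k = k" using permutes_not_in[OF \<sigma>(1), of k] by simp
      then show ?thesis using assms(4) 2 by simp
    next
      case 3
      then have "\<sigma> k = k" using permutes_not_in[OF \<sigma>(1), of k] by blast
      moreover have "k \<notin> keys a" "k \<notin> keys b" using 3 assms(2,3) by blast+
      ultimately show ?thesis by (simp add: in_keys_iff)
    qed (use \<sigma> in simp)
    then show "lookup (map_key \<sigma> b) k = lookup a k" by (simp add: lookup_map_key_permutes[OF \<sigma>(1)])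
  qed
  moreover have "permute_vars \<sigma> F = F" using assms(1) \<sigma>(1) by (simp add: sym_series_def)
  then have "F (map_key \<sigma> b) = F b" by (metis permute_vars_def)
  ultimately show ?thesis by simp
qed

lemma map_key_transpose_transpose:
  "map_key (Transposition.transpose i j) (map_key (Transposition.transpose i j) a) = a"
  by (simp add: map_key_compose map_key_id[folded id_def])

lemma other_exponents_map_key:
  assumes "bij \<sigma>"
  shows "other_exponents i (map_key \<sigma> a) = other_exponents (\<sigma> i) a"
proof -
  have inj: "inj \<sigma>" using assms by (rule bij_is_inj)
  have "\<sigma> ` (\<sigma> -` keys a - {i}) = keys a - {\<sigma> i}"
    using assms by (simp add: image_set_diff[OF inj] bij_is_surj surj_image_vimage_eq)
  then have "mset_set (keys a - {\<sigma> i}) = image_mset \<sigma> (mset_set (\<sigma> -` keys a - {i}))"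
    using image_mset_mset_set[of \<sigma> "\<sigma> -` keys a - {i}"] inj by (metis inj_on_subset subset_UNIV)
  then show ?thesis
    by (simp add: other_exponents_def keys_map_key[OF inj] map_key.rep_eq[OF inj]
        multiset.map_comp o_def)
qed

text \<open>The only decomposition of \<open>a\<close> that can contribute separates the full power
  of x_i from the rest, since \<open>monomial_sym S \<nu>\<close> does not involve x_i.\<close>

lemma times_var_power_monomial_sym:
  assumes "i \<notin> S"
  shows "times_series (var_power i d) (monomial_sym S \<nu>) a =
    (if lookup a i = d \<and> keys a - {i} \<subseteq> S \<and> other_exponents i a = mset \<nu> then 1 else 0)"
proof -
  let ?a = "update i 0 a"
  have keys: "keys ?a = keys a - {i}" by (simp add: keys_update)
  have exps: "exponents ?a = other_exponents i a"
    unfolding exponents_def other_exponents_def keys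
    by (intro image_mset_cong) (auto simp: lookup_update)
  have zero: "var_power i d b * monomial_sym S \<nu> c = 0"
    if "b + c = a" "\<not> (lookup a i = d \<and> b = single i d \<and> c = ?a)" for b c
  proof (rule ccontr)
    assume "var_power i d b * monomial_sym S \<nu> c \<noteq> 0"
    then have b: "b = single i d" and c: "keys c \<subseteq> S"
      by (auto simp: var_power_def monomial_sym_def split: if_splits)
    have ci: "lookup c i = 0" using c assms by (auto simp: in_keys_iff)
    have "lookup a i = d" using that(1) b ci by (auto simp: lookup_add)
    moreover have "c = ?a"
      by (rule poly_mapping_eqI)
        (use that(1) b ci in \<open>auto simp: lookup_update lookup_add lookup_single when_def\<close>)
    ultimately show False using that(2) b by simp
  qed
  show ?thesis
  proof (cases "lookup a i = d")
    case True
    have dec: "single i d + ?a = a"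
      by (rule poly_mapping_eqI) (use True in \<open>auto simp: lookup_update lookup_add lookup_single when_def\<close>)
    have "times_series (var_power i d) (monomial_sym S \<nu>) a =
      (\<Sum>(b, c)\<in>{(single i d, ?a)}. var_power i d b * monomial_sym S \<nu> c)"
      unfolding times_series_def
    proof (rule sum.mono_neutral_right[OF finite_monomial_decompositions])
      show "{(single i d, ?a)} \<subseteq> {(b, c). b + c = a}" using dec by simp
      show "\<forall>z\<in>{(b, c). b + c = a} - {(single i d, ?a)}.
        (case z of (b, c) \<Rightarrow> var_power i d b * monomial_sym S \<nu> c) = 0"
      proof
        fix z assume "z \<in> {(b, c). b + c = a} - {(single i d, ?a)}"
        then obtain b c where "z = (b, c)" "b + c = a" "\<not> (b = single i d \<and> c = ?a)" by blast
        then show "(case z of (b, c) \<Rightarrow> var_power i d b * monomial_sym S \<nu> c) = 0"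
          using zero[of b c] by simp
      qed
    qed
    then show ?thesis using True by (simp add: var_power_def monomial_sym_def keys exps)
  next
    case False
    then have "times_series (var_power i d) (monomial_sym S \<nu>) a = 0"
      unfolding times_series_def by (intro sum.neutral ballI) (use zero in \<open>clarsimp simp del: mult_eq_0_iff\<close>)
    then show ?thesis using False by simp
  qed
qed

section \<open>Reading off the coefficients of an expansion\<close>

lemma size_other_exponents:
  assumes "keys a \<subseteq> {1..N}" "i \<in> {1..N}"
  shows "size (other_exponents i a) \<le> N - 1"
proof -
  have "card (keys a - {i}) \<le> card ({1..N} - {i})" using assms by (intro card_mono) auto
  then show ?thesis using assms(2) by (simp add: other_exponents_def)
qed

lemma partition_of_multiset:
  assumes "0 \<notin># A"
  shows "rev (sorted_list_of_multiset A) \<in> partitions" "mset (rev (sorted_list_of_multiset A)) = A"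
proof -
  have "p > 0" if "p \<in># A" for p using assms that by (cases p) auto
  then show "rev (sorted_list_of_multiset A) \<in> partitions"
    using sorted_sorted_list_of_multiset[of A] by (simp add: partitions_def sorted_wrt_rev)
qed simp

lemma partitions_mset_inject:
  assumes "\<mu> \<in> partitions" "\<nu> \<in> partitions" "mset \<mu> = mset \<nu>"
  shows "\<mu> = \<nu>"
proof -
  have *: "sorted (rev \<mu>)" "sorted (rev \<nu>)" using assms by (simp_all add: partitions_def sorted_wrt_rev)
  have "sort (rev \<mu>) = rev \<nu>" by (rule properties_for_sort) (simp_all add: * assms(3))
  moreover have "sort (rev \<mu>) = rev \<mu>" by (rule properties_for_sort) (simp_all add: *)
  ultimately show ?thesis by simp
qed

lemma other_exponents_pos: "0 \<notin># other_exponents i a"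
  by (auto simp: other_exponents_def in_keys_iff)

text \<open>Every monomial in the given variables occurs in exactly one of the basis series, the one
  given by its exponent of x_i and its other exponents in decreasing order.\<close>

lemma expansion_eq:
  assumes "\<And>d \<nu>. \<not> (\<nu> \<in> partitions \<and> length \<nu> \<le> N - 1) \<Longrightarrow> c d \<nu> = 0" "i \<in> {1..N}"
  shows "expansion i N c a = (if keys a \<subseteq> {1..N}
    then c (lookup a i) (rev (sorted_list_of_multiset (other_exponents i a))) else 0)"
proof -
  define \<mu> where "\<mu> = rev (sorted_list_of_multiset (other_exponents i a))"
  have \<mu>: "\<mu> \<in> partitions" "mset \<mu> = other_exponents i a"
    unfolding \<mu>_def by (intro partition_of_multiset other_exponents_pos)+
  have keys: "keys a - {i} \<subseteq> {1..N} - {i} \<longleftrightarrow> keys a \<subseteq> {1..N}" using assms(2) by blast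
  let ?h = "\<lambda>(d, \<nu>). c d \<nu> * times_series (var_power i d) (monomial_sym ({1..N} - {i}) \<nu>) a"
  have h: "?h (d, \<nu>) = (if (d, \<nu>) = (lookup a i, \<mu>) \<and> keys a \<subseteq> {1..N} then c (lookup a i) \<mu> else 0)" for d \<nu>
  proof (cases "\<nu> \<in> partitions")
    case True
    then have "other_exponents i a = mset \<nu> \<longleftrightarrow> \<nu> = \<mu>" using \<mu> partitions_mset_inject by metis
    then show ?thesis by (auto simp: times_var_power_monomial_sym keys[unfolded One_nat_def])
  next
    case False
    then show ?thesis using assms(1)[of \<nu>] \<mu>(1) by auto
  qed
  have "expansion i N c a = Sum_any ?h" by (simp add: expansion_def)
  also have "\<dots> = sum ?h {(lookup a i, \<mu>)}"
    by (rule Sum_any.expand_superset) (use h in \<open>auto split: if_splits\<close>)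
  also have "\<dots> = (if keys a \<subseteq> {1..N} then c (lookup a i) \<mu> else 0)" using h[of "lookup a i" \<mu>] by simp
  finally show ?thesis by (simp add: \<mu>_def)
qed

lemma monomial_exists:
  assumes "i \<in> {1..N}" "\<nu> \<in> partitions" "length \<nu> \<le> N - 1"
  shows "\<exists>a. keys a \<subseteq> {1..N} \<and> lookup a i = d \<and> other_exponents i a = mset \<nu>"
proof (intro exI conjI)
  let ?\<tau> = "Transposition.transpose i N"
  \<comment> \<open>\<open>monomial_at\<close> has its distinguished variable in position N; the
    transposition moves it to i.\<close>
  let ?a = "map_key ?\<tau> (monomial_at N d \<nu>)"
  have len: "length \<nu> < N" using assms by auto
  have bij: "bij ?\<tau>" by simp
  have "filter_mset (\<lambda>p. 0 < p) (mset \<nu>) = mset \<nu>"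
    using assms(2) by (simp add: partitions_def filter_mset_eq_conv)
  then show "other_exponents i ?a = mset \<nu>"
    using other_exponents_monomial_at[OF len, of d] by (simp add: other_exponents_map_key)
  show "lookup ?a i = d" using lookup_monomial_at[OF len] by (simp add: map_key.rep_eq)
  show "keys ?a \<subseteq> {1..N}"
  proof
    fix k assume "k \<in> keys ?a"
    then have "?\<tau> k \<in> {1..N}" using keys_monomial_at[OF len, of d] by (auto simp: keys_map_key)
    then show "k \<in> {1..N}" using assms(1) by (auto simp: Transposition.transpose_def split: if_splits)
  qed
qed

lemma coeff_series_eq:
  assumes F: "F \<in> sym_series i N" and i: "i \<in> {1..N}"
    and a: "keys a \<subseteq> {1..N}" "\<nu> \<in> partitions" "other_exponents i a = mset \<nu>"
  shows "coeff_series i N F (lookup a i) \<nu> = F a"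
proof -
  define P where "P d \<nu> a \<longleftrightarrow> \<nu> \<in> partitions \<and> keys a \<subseteq> {1..N} \<and> lookup a i = d \<and> other_exponents i a = mset \<nu>"
    for d \<nu> and a :: monomial
  \<comment> \<open>The choice of representative is harmless, as \<open>F\<close> is constant on the
    monomials with \<open>P d \<nu>\<close>. Uniqueness of the family then follows by evaluating any
    other expansion at one such monomial.\<close>
  define c where "c d \<nu> = (if \<exists>a. P d \<nu> a then F (SOME a. P d \<nu> a) else 0)" for d \<nu>
  have c: "c d \<nu> = F a" if "P d \<nu> a" for d \<nu> a
  proof -
    have "P d \<nu> (SOME a. P d \<nu> a)" using that by (rule someI)
    then have "F (SOME a. P d \<nu> a) = F a" using that by (intro sym_series_eqI[OF F]) (auto simp: P_def)
    then show ?thesis using that by (auto simp: c_def)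
  qed
  have c0: "c d \<nu> = 0" if "\<not> (\<nu> \<in> partitions \<and> length \<nu> \<le> N - 1)" for d \<nu>
  proof -
    have "\<not> P d \<nu> a" for a
      using that size_other_exponents[OF _ i, of a] by (auto simp: P_def)
    then show ?thesis by (simp add: c_def)
  qed
  have "(THE c. (\<forall>d \<nu>. \<not> (\<nu> \<in> partitions \<and> length \<nu> \<le> N - 1) \<longrightarrow> c d \<nu> = 0) \<and> F = expansion i N c) = c"
  proof (rule the_equality, intro conjI allI impI)
    show "F = expansion i N c"
    proof
      fix b
      show "F b = expansion i N c b"
      proof (cases "keys b \<subseteq> {1..N}")
        case True
        have "P (lookup b i) (rev (sorted_list_of_multiset (other_exponents i b))) b"
          unfolding P_def using partition_of_multiset[OF other_exponents_pos[of i b]] True by simp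
        then have "F b = (if keys b \<subseteq> {1..N} then c (lookup b i) (rev (sorted_list_of_multiset (other_exponents i b))) else 0)"
          using True c by simp
        then show ?thesis using expansion_eq[where c = c, OF c0 i] by metis
      next
        case False
        moreover from this have "F b = 0" using F by (auto simp: sym_series_def)
        ultimately show ?thesis using expansion_eq[where c = c, OF c0 i] by metis
      qed
    qed
    fix c' assume c': "(\<forall>d \<nu>. \<not> (\<nu> \<in> partitions \<and> length \<nu> \<le> N - 1) \<longrightarrow> c' d \<nu> = 0) \<and> F = expansion i N c'"
    show "c' = c"
    proof (intro ext)
      fix d \<nu>
      show "c' d \<nu> = c d \<nu>"
      proof (cases "\<nu> \<in> partitions \<and> length \<nu> \<le> N - 1")
        case True
        then obtain b where b: "keys b \<subseteq> {1..N}" "lookup b i = d" "other_exponents i b = mset \<nu>"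
          using monomial_exists[OF i] by blast
        have "rev (sorted_list_of_multiset (other_exponents i b)) = \<nu>"
          using partition_of_multiset[OF other_exponents_pos[of i b]] b True
          by (intro partitions_mset_inject) auto
        then have "expansion i N c' b = c' d \<nu>"
          using b c' by (subst expansion_eq[OF _ i]) auto
        then have "F b = c' d \<nu>" using c' by metis
        moreover have "c d \<nu> = F b" using b True by (intro c) (simp add: P_def)
        ultimately show ?thesis by simp
      qed (use c' c0 in auto)
    qed
  qed (use c0 in auto)
  then have "coeff_series i N F = c" by (simp add: coeff_series_def)
  then show ?thesis using c[of "lookup a i" \<nu> a] a by (simp add: P_def)
qed

text \<open>The hypotheses of the theorem distinguish x_1 after a swap, whereas the operators act on
  the last variable. Undoing the swap gives coefficients of the series itself with x_M
  distinguished.\<close>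

lemma coeff_series_swap_vars:
  assumes "swap_vars 1 M F \<in> sym_series 1 M" "length \<alpha> < M"
  shows "coeff_series 1 M (swap_vars 1 M F) d (partition_of \<alpha>) = F (monomial_at M d \<alpha>)"
proof -
  let ?\<tau> = "Transposition.transpose 1 M"
  define a where "a = map_key ?\<tau> (monomial_at M d \<alpha>)"
  have M: "1 \<in> {1..M}" using assms(2) by auto
  have 1: "lookup a 1 = d" using lookup_monomial_at[OF assms(2)] by (simp add: a_def map_key.rep_eq)
  have "keys a \<subseteq> {1..M}"
  proof
    fix k assume "k \<in> keys a"
    then have "?\<tau> k \<in> {1..M}" using keys_monomial_at[OF assms(2), of d] by (auto simp: a_def keys_map_key)
    then show "k \<in> {1..M}" using M by (auto simp: Transposition.transpose_def split: if_splits)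
  qed
  moreover have "other_exponents 1 a = mset (partition_of \<alpha>)"
    using other_exponents_monomial_at[OF assms(2), of d] other_exponents_map_key[of ?\<tau> 1 "monomial_at M d \<alpha>"]
    by (simp add: a_def mset_partition_of)
  ultimately have "coeff_series 1 M (swap_vars 1 M F) d (partition_of \<alpha>) = swap_vars 1 M F a"
    using coeff_series_eq[OF assms(1) M, of a "partition_of \<alpha>"] partition_of_in_partitions 1 by simp
  also have "\<dots> = F (monomial_at M d \<alpha>)"
    by (simp add: swap_vars_def permute_vars_def a_def map_key_transpose_transpose)
  finally show ?thesis .
qed

section \<open>Limits of coefficients\<close>

lemma d_op_eq: "d_op i G b = G (b + single i 1)"
proof -
  have "{a. (if lookup a i \<ge> 1 then Some (update i (lookup a i - 1) a) else None) = Some b} = {b + single i 1}"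
  proof (intro equalityI subsetI)
    fix a assume "a \<in> {a. (if lookup a i \<ge> 1 then Some (update i (lookup a i - 1) a) else None) = Some b}"
    then have a: "lookup a i \<ge> 1" "b = update i (lookup a i - 1) a" by (auto split: if_splits)
    then have "a = b + single i 1"
      by (intro poly_mapping_eqI) (auto simp: lookup_add lookup_update lookup_single when_def)
    then show "a \<in> {b + single i 1}" by simp
  next
    fix a assume a: "a \<in> {b + single i 1}"
    then have "update i (lookup a i - 1) a = b"
      by (intro poly_mapping_eqI) (auto simp: lookup_add lookup_update lookup_single when_def)
    moreover have "lookup a i \<ge> 1" using a by (simp add: lookup_add)
    ultimately show "a \<in> {a. (if lookup a i \<ge> 1 then Some (update i (lookup a i - 1) a) else None) = Some b}"
      by simp
  qed
  then show ?thesis unfolding d_op_def lin_ext_def by simp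
qed

text \<open>\<open>C_op\<close> erases x_j and passes its exponent, less one, to x_i. Hence
  \<open>b\<close> has a preimage only if x_j is absent from it, and the preimage carries the
  exponent of x_i, plus one, at x_j.\<close>

lemma C_op_eq:
  assumes "i \<noteq> j"
  shows "C_op i j G b = (if lookup b j = 0 then G (update i 0 b + single j (Suc (lookup b i))) else 0)"
proof -
  let ?t = "\<lambda>a. if lookup a i = 0 \<and> lookup a j \<ge> 1
     then Some (update i (lookup a j - 1) (update j 0 a)) else None"
  let ?a = "update i 0 b + single j (Suc (lookup b i))"
  have "{a. ?t a = Some b} = (if lookup b j = 0 then {?a} else {})"
  proof (intro equalityI subsetI)
    fix a assume "a \<in> {a. ?t a = Some b}"
    then have a: "lookup a i = 0" "lookup a j \<ge> 1" "b = update i (lookup a j - 1) (update j 0 a)"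
      by (auto split: if_splits)
    then have "a = ?a"
      by (intro poly_mapping_eqI) (use assms in \<open>auto simp: lookup_add lookup_update lookup_single when_def\<close>)
    moreover have "lookup b j = 0" using a assms by (simp add: lookup_update)
    ultimately show "a \<in> (if lookup b j = 0 then {?a} else {})" by simp
  next
    fix a assume "a \<in> (if lookup b j = 0 then {?a} else {})"
    then have a: "lookup b j = 0" "a = ?a" by (auto split: if_splits)
    have "lookup a i = 0" "lookup a j = Suc (lookup b i)"
      using a assms by (auto simp: lookup_add lookup_update lookup_single when_def)
    moreover have "update i (lookup b i) (update j 0 a) = b"
      by (intro poly_mapping_eqI) (use a assms in \<open>auto simp: lookup_add lookup_update lookup_single when_def\<close>)
    ultimately show "a \<in> {a. ?t a = Some b}" by simp
  qed
  then show ?thesis unfolding C_op_def lin_ext_def by simp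
qed

lemma permute_vars_times_series:
  assumes "\<sigma> permutes S"
  shows "permute_vars \<sigma> (times_series F G) = times_series (permute_vars \<sigma> F) (permute_vars \<sigma> G)"
proof
  fix a
  have inj: "inj \<sigma>" "inj (inv \<sigma>)" using assms permutes_inj permutes_inv by blast+
  have inv: "map_key \<sigma> (map_key (inv \<sigma>) b) = b" "map_key (inv \<sigma>) (map_key \<sigma> b) = b" for b :: monomial
    using assms inj by (simp_all add: map_key_compose permutes_inv_o map_key_id[folded id_def])
  have "(\<Sum>(b, c) | b + c = map_key \<sigma> a. F b * G c) = (\<Sum>(b, c) | b + c = a. F (map_key \<sigma> b) * G (map_key \<sigma> c))"
    by (rule sum.reindex_bij_witness[where i = "\<lambda>(b, c). (map_key \<sigma> b, map_key \<sigma> c)"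
          and j = "\<lambda>(b, c). (map_key (inv \<sigma>) b, map_key (inv \<sigma>) c)"])
      (auto simp: inv inj simp flip: map_key_plus)
  then show "permute_vars \<sigma> (times_series F G) a = times_series (permute_vars \<sigma> F) (permute_vars \<sigma> G) a"
    by (simp add: permute_vars_def times_series_def)
qed

section \<open>Symmetry under the operators\<close>

lemma sym_series_support: "F \<in> sym_series i N \<Longrightarrow> \<not> keys a \<subseteq> {1..N} \<Longrightarrow> F a = 0"
  by (auto simp: sym_series_def)

lemma sym_series_permute:
  "F \<in> sym_series i N \<Longrightarrow> \<sigma> permutes ({1..N} - {i}) \<Longrightarrow> F (map_key \<sigma> a) = F a"
  unfolding sym_series_def permute_vars_def by (auto dest: fun_cong)

lemma sym_seriesI:
  assumes "\<And>a. \<not> keys a \<subseteq> {1..N} \<Longrightarrow> F a = 0"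
    and "\<And>\<sigma> a. \<sigma> permutes ({1..N} - {i}) \<Longrightarrow> F (map_key \<sigma> a) = F a"
  shows "F \<in> sym_series i N"
  using assms by (auto simp: sym_series_def permute_vars_def fun_eq_iff)

lemma keys_add_nat: "keys (a + b) = keys a \<union> keys (b :: monomial)"
  by (auto simp: in_keys_iff lookup_add)

lemma times_series_sym_series:
  assumes "F \<in> sym_series i N" "G \<in> sym_series i N"
  shows "times_series F G \<in> sym_series i N"
proof (rule sym_seriesI)
  fix a :: monomial assume a: "\<not> keys a \<subseteq> {1..N}"
  have "F b * G c = 0" if "b + c = a" for b c
  proof (cases "keys b \<subseteq> {1..N}")
    case True
    then have "\<not> keys c \<subseteq> {1..N}" using a that keys_add_nat[of b c] by auto
    then show ?thesis using sym_series_support[OF assms(2)] by simp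
  qed (use sym_series_support[OF assms(1)] in simp)
  then show "times_series F G a = 0"
    unfolding times_series_def by (intro sum.neutral ballI) (clarsimp simp del: mult_eq_0_iff)
next
  fix \<sigma> and a :: monomial assume \<sigma>: "\<sigma> permutes ({1..N} - {i})"
  have "permute_vars \<sigma> F = F" "permute_vars \<sigma> G = G" using assms \<sigma> by (simp_all add: sym_series_def)
  then show "times_series F G (map_key \<sigma> a) = times_series F G a"
    using fun_cong[OF permute_vars_times_series[OF \<sigma>, of F G], of a] by (simp add: permute_vars_def)
qed

text \<open>A permutation \<open>\<sigma>\<close> fixing i carries \<open>C_op i j\<close> to
  \<open>C_op i (\<sigma> j)\<close>; summing over j restores the symmetry.\<close>

lemma Q_op_sym_series:
  assumes f: "f \<in> sym_series i N" and G: "G \<in> sym_series i N" and i: "i \<in> {1..N}"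
  shows "Q_op \<theta>s i N f G \<in> sym_series i N"
proof (rule sym_seriesI)
  fix a :: monomial assume a: "\<not> keys a \<subseteq> {1..N}"
  have "d_op i G a = 0"
    using a by (auto simp: d_op_eq keys_add_nat intro!: sym_series_support[OF G])
  moreover have "C_op i j G a = 0" if "j \<in> {1..N} - {i}" for j
  proof -
    have "\<not> keys (update i 0 a + single j (Suc (lookup a i))) \<subseteq> {1..N}"
      using a i that by (auto simp: keys_add_nat keys_update)
    then show ?thesis using sym_series_support[OF G] that by (auto simp: C_op_eq)
  qed
  ultimately show "Q_op \<theta>s i N f G a = 0"
    using sym_series_support[OF times_series_sym_series[OF f G] a] by (simp add: Q_op_def)
next
  fix \<sigma> and a :: monomial assume \<sigma>: "\<sigma> permutes ({1..N} - {i})"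
  note lk = lookup_map_key_permutes[OF \<sigma>]
  have \<sigma>i: "\<sigma> i = i" using permutes_not_in[OF \<sigma>, of i] by simp
  have inj: "\<sigma> k = \<sigma> l \<longleftrightarrow> k = l" for k l using permutes_inj[OF \<sigma>] by (auto dest: injD)
  have "map_key \<sigma> a + single i 1 = map_key \<sigma> (a + single i 1)"
    by (rule poly_mapping_eqI) (use \<sigma>i inj[of i] in \<open>auto simp: lk lookup_add lookup_single when_def\<close>)
  then have d: "d_op i G (map_key \<sigma> a) = d_op i G a"
    by (simp add: d_op_eq sym_series_permute[OF G \<sigma>])
  have C: "C_op i j G (map_key \<sigma> a) = C_op i (\<sigma> j) G a" if "j \<in> {1..N} - {i}" for j
  proof -
    have ne: "i \<noteq> j" "i \<noteq> \<sigma> j" using that \<sigma>i inj[of i j] by auto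
    have "update i 0 (map_key \<sigma> a) + single j (Suc (lookup a i)) =
      map_key \<sigma> (update i 0 a + single (\<sigma> j) (Suc (lookup a i)))"
      by (rule poly_mapping_eqI)
        (use \<sigma>i inj[of i] inj[of j] in \<open>auto simp: lk lookup_add lookup_update lookup_single when_def\<close>)
    then show ?thesis using ne by (simp add: C_op_eq lk \<sigma>i sym_series_permute[OF G \<sigma>])
  qed
  have "(\<Sum>j\<in>{1..N} - {i}. (d_op i G (map_key \<sigma> a) - C_op i j G (map_key \<sigma> a)) / of_nat N) =
    (\<Sum>j\<in>{1..N} - {i}. (d_op i G a - C_op i (\<sigma> j) G a) / of_nat N)"
    using C by (intro sum.cong) (simp_all add: d)
  also have "\<dots> = (\<Sum>j\<in>{1..N} - {i}. (d_op i G a - C_op i j G a) / of_nat N)"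
    using sum.permute[OF \<sigma>, of "\<lambda>j. (d_op i G a - C_op i j G a) / of_nat N"] by (simp add: o_def)
  finally show "Q_op \<theta>s i N f G (map_key \<sigma> a) = Q_op \<theta>s i N f G a"
    using sym_series_permute[OF times_series_sym_series[OF f G] \<sigma>] by (simp add: Q_op_def)
qed

definition coeff_limit :: "(nat \<Rightarrow> mseries) \<Rightarrow> (nat \<Rightarrow> nat list \<Rightarrow> complex) \<Rightarrow> bool" where
  "coeff_limit h s \<longleftrightarrow> (\<forall>\<^sub>F M in sequentially. h M \<in> sym_series M M) \<and>
     (\<forall>d \<alpha>. (\<lambda>M. h M (monomial_at M d \<alpha>)) \<longlonglongrightarrow> s d \<alpha>)"

lemma sym_series_monomial_at_eqI:
  assumes "F \<in> sym_series M M" "length \<alpha> < M" "length \<beta> < M"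
    and "filter_mset (\<lambda>p. 0 < p) (mset \<alpha>) = filter_mset (\<lambda>p. 0 < p) (mset \<beta>)"
  shows "F (monomial_at M d \<alpha>) = F (monomial_at M d \<beta>)"
  using assms
  by (intro sym_series_eqI[OF assms(1)] keys_monomial_at)
    (simp_all add: lookup_monomial_at other_exponents_monomial_at)

lemma coeff_limit_zero_insensitive:
  assumes "coeff_limit h s"
  shows "zero_insensitive (s d)"
  unfolding zero_insensitive_def
proof (intro allI)
  fix \<alpha> \<beta> :: "nat list"
  let ?l = "length (\<alpha> @ 0 # \<beta>)"
  have "(\<lambda>M. h M (monomial_at M d (\<alpha> @ \<beta>))) \<longlonglongrightarrow> s d (\<alpha> @ 0 # \<beta>)"
  proof (rule Lim_transform_eventually)
    show "(\<lambda>M. h M (monomial_at M d (\<alpha> @ 0 # \<beta>))) \<longlonglongrightarrow> s d (\<alpha> @ 0 # \<beta>)"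
      using assms by (simp add: coeff_limit_def)
    have "\<forall>\<^sub>F M in sequentially. h M \<in> sym_series M M" using assms by (simp add: coeff_limit_def)
    then show "\<forall>\<^sub>F M in sequentially. h M (monomial_at M d (\<alpha> @ 0 # \<beta>)) = h M (monomial_at M d (\<alpha> @ \<beta>))"
      using eventually_gt_at_top[of ?l]
      by eventually_elim (intro sym_series_monomial_at_eqI, auto)
  qed
  moreover have "(\<lambda>M. h M (monomial_at M d (\<alpha> @ \<beta>))) \<longlonglongrightarrow> s d (\<alpha> @ \<beta>)"
    using assms by (simp add: coeff_limit_def)
  ultimately show "s d (\<alpha> @ 0 # \<beta>) = s d (\<alpha> @ \<beta>)" by (rule LIMSEQ_unique)
qed

text \<open>The restriction on the length matters because the variable that belongs to the head of a
  list is determined by the length of its tail.\<close>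

lemma convolve_cong:
  assumes "\<And>\<beta>. length \<beta> = length \<alpha> \<Longrightarrow> F \<beta> = F' \<beta>" "\<And>\<beta>. length \<beta> = length \<alpha> \<Longrightarrow> G \<beta> = G' \<beta>"
  shows "convolve F G \<alpha> = convolve F' G' \<alpha>"
  using assms
proof (induction \<alpha> arbitrary: F G F' G')
  case (Cons a \<alpha>)
  have "convolve (\<lambda>\<beta>. F (b # \<beta>)) (\<lambda>\<beta>. G ((a - b) # \<beta>)) \<alpha> =
        convolve (\<lambda>\<beta>. F' (b # \<beta>)) (\<lambda>\<beta>. G' ((a - b) # \<beta>)) \<alpha>" for b
    by (intro Cons.IH Cons.prems) auto
  then show ?case by simp
qed simp

lemma tendsto_convolve:
  assumes "\<And>\<beta>. (\<lambda>M. F M \<beta>) \<longlonglongrightarrow> f \<beta>" "\<And>\<beta>. (\<lambda>M. G M \<beta>) \<longlonglongrightarrow> g \<beta>"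
  shows "(\<lambda>M. convolve (F M) (G M) \<alpha>) \<longlonglongrightarrow> convolve f g \<alpha>"
  using assms
proof (induction \<alpha> arbitrary: F G f g)
  case Nil
  then show ?case by (auto intro: tendsto_mult)
next
  case (Cons a \<alpha>)
  have "(\<lambda>M. convolve (\<lambda>\<beta>. F M (b # \<beta>)) (\<lambda>\<beta>. G M ((a - b) # \<beta>)) \<alpha>) \<longlonglongrightarrow>
        convolve (\<lambda>\<beta>. f (b # \<beta>)) (\<lambda>\<beta>. g ((a - b) # \<beta>)) \<alpha>" for b
    by (rule Cons.IH) (rule Cons.prems)+
  then show ?case by (auto intro: tendsto_sum)
qed

lemma sum_decompositions_monomial_of_list:
  "(\<Sum>(b, c) | b + c = monomial_of_list \<alpha>. F b * G c) =
   convolve (\<lambda>\<beta>. F (monomial_of_list \<beta>)) (\<lambda>\<beta>. G (monomial_of_list \<beta>)) \<alpha>"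
proof (induction \<alpha> arbitrary: F G)
  case Nil
  have "{(b, c). b + c = (0 :: monomial)} = {(0, 0)}"
  proof (intro equalityI subsetI)
    fix z :: "monomial \<times> monomial" assume "z \<in> {(b, c). b + c = 0}"
    then obtain b c where z: "z = (b, c)" "b + c = 0" by auto
    have "keys b = {}" "keys c = {}" using keys_add_nat[of b c] z(2) by auto
    then show "z \<in> {(0, 0)}" using z(1) by simp
  qed simp
  then show ?case by simp
next
  case (Cons x \<alpha>)
  let ?k = "Suc (length \<alpha>)"
  have "?k \<notin> keys (monomial_of_list \<alpha>)" using keys_monomial_of_list[of \<alpha>] by force
  then have "(\<Sum>(b, c) | b + c = monomial_of_list (x # \<alpha>). F b * G c) =
    (\<Sum>y\<le>x. \<Sum>(b, c) | b + c = monomial_of_list \<alpha>. F (b + single ?k y) * G (c + single ?k (x - y)))"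
    unfolding monomial_of_list.simps by (rule sum_decompositions_add_single)
  also have "\<dots> = (\<Sum>y\<le>x. convolve (\<lambda>\<beta>. F (monomial_of_list \<beta> + single ?k y))
      (\<lambda>\<beta>. G (monomial_of_list \<beta> + single ?k (x - y))) \<alpha>)"
    by (rule sum.cong[OF refl]) (rule Cons.IH)
  also have "\<dots> = (\<Sum>y\<le>x. convolve (\<lambda>\<beta>. F (monomial_of_list (y # \<beta>)))
      (\<lambda>\<beta>. G (monomial_of_list ((x - y) # \<beta>))) \<alpha>)"
    by (intro sum.cong convolve_cong refl) simp_all
  finally show ?case by simp
qed

lemma times_series_monomial_at:
  assumes "length \<alpha> < M"
  shows "times_series F G (monomial_at M d \<alpha>) =
    (\<Sum>y\<le>d. convolve (\<lambda>\<beta>. F (monomial_at M y \<beta>)) (\<lambda>\<beta>. G (monomial_at M (d - y) \<beta>)) \<alpha>)"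
proof -
  have "M \<notin> keys (monomial_of_list \<alpha>)" using keys_monomial_of_list[of \<alpha>] assms by force
  then have "times_series F G (monomial_at M d \<alpha>) =
    (\<Sum>y\<le>d. \<Sum>(b, c) | b + c = monomial_of_list \<alpha>. F (b + single M y) * G (c + single M (d - y)))"
    unfolding times_series_def monomial_at_def by (rule sum_decompositions_add_single)
  also have "\<dots> = (\<Sum>y\<le>d. convolve (\<lambda>\<beta>. F (monomial_at M y \<beta>)) (\<lambda>\<beta>. G (monomial_at M (d - y) \<beta>)) \<alpha>)"
    unfolding monomial_at_def
    by (rule sum.cong[OF refl]) (rule sum_decompositions_monomial_of_list)
  finally show ?thesis .
qed

lemma tendsto_times_series:
  assumes "coeff_limit F f" "coeff_limit G g"
  shows "(\<lambda>M. times_series (F M) (G M) (monomial_at M d \<alpha>)) \<longlonglongrightarrow> limit_times f g d \<alpha>"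
proof (rule Lim_transform_eventually)
  show "(\<lambda>M. \<Sum>y\<le>d. convolve (\<lambda>\<beta>. F M (monomial_at M y \<beta>)) (\<lambda>\<beta>. G M (monomial_at M (d - y) \<beta>)) \<alpha>)
      \<longlonglongrightarrow> limit_times f g d \<alpha>"
    unfolding limit_times_def using assms
    by (intro tendsto_sum tendsto_convolve) (auto simp: coeff_limit_def)
  show "\<forall>\<^sub>F M in sequentially.
      (\<Sum>y\<le>d. convolve (\<lambda>\<beta>. F M (monomial_at M y \<beta>)) (\<lambda>\<beta>. G M (monomial_at M (d - y) \<beta>)) \<alpha>) =
      times_series (F M) (G M) (monomial_at M d \<alpha>)"
    using eventually_gt_at_top[of "length \<alpha>"]
    by eventually_elim (rule times_series_monomial_at[symmetric])
qed

text \<open>The operator \<open>d_op\<close> is the same for all M - 1 values of j. For the z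
  variables besides x_M that occur in the monomial, \<open>C_op\<close> contributes 0. The other M -
  1 - z values of j all give the same coefficient by symmetry. Divided by M, both counts tend to
  1.\<close>

lemma sum_d_op_C_op:
  assumes "G \<in> sym_series M M" "Suc (length \<alpha>) < M"
  defines "z \<equiv> size (filter_mset (\<lambda>p. 0 < p) (mset \<alpha>))"
  shows "(\<Sum>j\<in>{1..M} - {M}. (d_op M G (monomial_at M d \<alpha>) - C_op M j G (monomial_at M d \<alpha>)) / of_nat M) =
    (1 - of_nat 1 / of_nat M) * G (monomial_at M (Suc d) \<alpha>) -
    (1 - of_nat (Suc z) / of_nat M) * G (monomial_at M 0 (Suc d # \<alpha>))"
proof -
  let ?a = "monomial_at M d \<alpha>" and ?S = "{1..M} - {M}"
  have len: "length \<alpha> < M" "length (Suc d # \<alpha>) < M" using assms(2) by auto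
  have lookup: "lookup ?a M = d" by (rule lookup_monomial_at[OF len(1)])
  have keys: "keys ?a \<subseteq> {1..M}" by (rule keys_monomial_at[OF len(1)])
  have upd: "update M 0 ?a = monomial_of_list \<alpha>"
  proof (rule poly_mapping_eqI)
    fix k
    have "M \<notin> keys (monomial_of_list \<alpha>)" using keys_monomial_of_list[of \<alpha>] len(1) by force
    then show "lookup (update M 0 ?a) k = lookup (monomial_of_list \<alpha>) k"
      by (auto simp: monomial_at_def lookup_update lookup_add lookup_single in_keys_iff when_def)
  qed
  have eM: "other_exponents M (monomial_of_list \<alpha>) = filter_mset (\<lambda>p. 0 < p) (mset \<alpha>)"
    using other_exponents_monomial_at[OF len(1), of 0] by (simp add: monomial_at_def)
  have d: "d_op M G ?a = G (monomial_at M (Suc d) \<alpha>)"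
    by (simp add: d_op_eq monomial_at_def add.assoc flip: single_add)
  have C: "C_op M j G ?a = (if j \<in> keys ?a then 0 else G (monomial_at M 0 (Suc d # \<alpha>)))"
    if j: "j \<in> ?S" for j
  proof (cases "j \<in> keys ?a")
    case False
    then have j0: "j \<notin> keys (monomial_of_list \<alpha>)" by (auto simp: monomial_at_def keys_add_nat)
    have "G (monomial_of_list \<alpha> + single j (Suc d)) = G (monomial_at M 0 (Suc d # \<alpha>))"
    proof (rule sym_series_eqI[OF assms(1)])
      show "keys (monomial_of_list \<alpha> + single j (Suc d)) \<subseteq> {1..M}"
        using j keys_monomial_of_list[of \<alpha>] len(1) by (auto simp: keys_add_nat)
      show "keys (monomial_at M 0 (Suc d # \<alpha>)) \<subseteq> {1..M}" by (rule keys_monomial_at[OF len(2)])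
      have "M \<notin> keys (monomial_of_list \<alpha>)" using keys_monomial_of_list[of \<alpha>] len(1) by force
      then show "lookup (monomial_of_list \<alpha> + single j (Suc d)) M = lookup (monomial_at M 0 (Suc d # \<alpha>)) M"
        using j lookup_monomial_at[OF len(2)] by (simp add: lookup_add lookup_single in_keys_iff)
      show "other_exponents M (monomial_of_list \<alpha> + single j (Suc d)) =
        other_exponents M (monomial_at M 0 (Suc d # \<alpha>))"
        using j other_exponents_monomial_at[OF len(2), of 0] by (simp add: other_exponents_add_single[OF j0] eM)
    qed
    then show ?thesis using False j by (simp add: C_op_eq upd lookup in_keys_iff)
  next
    case True
    then show ?thesis using j by (simp add: C_op_eq in_keys_iff)
  qed
  have "card (?S - keys ?a) = card ?S - card (keys ?a - {M})"
  proof -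
    have "?S - keys ?a = ?S - (keys ?a - {M})" by blast
    moreover have "keys ?a - {M} \<subseteq> ?S" using keys by blast
    ultimately show ?thesis by (simp add: card_Diff_subset)
  qed
  also have "card (keys ?a - {M}) = z"
    using other_exponents_monomial_at[OF len(1), of d] arg_cong[of _ _ size]
    by (simp add: other_exponents_def z_def) (metis size_image_mset size_mset_set)
  \<comment> \<open>The number of j for which x_j is absent from the monomial.\<close>
  finally have card: "card (?S - keys ?a) = M - 1 - z" using assms(2) by simp
  have "z \<le> length \<alpha>" using size_filter_mset_lesseq[of _ "mset \<alpha>"] by (simp add: z_def)
  then have zM: "Suc z \<le> M" using len(1) by simp
  have "(\<Sum>j\<in>?S. C_op M j G ?a) = (\<Sum>j\<in>?S - keys ?a. G (monomial_at M 0 (Suc d # \<alpha>)))"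
    by (rule sum.mono_neutral_cong_right) (auto simp: C)
  also have "\<dots> = of_nat (M - Suc z) * G (monomial_at M 0 (Suc d # \<alpha>))" using card by simp
  finally have "(\<Sum>j\<in>?S. d_op M G ?a - C_op M j G ?a) =
    of_nat (M - 1) * G (monomial_at M (Suc d) \<alpha>) - of_nat (M - Suc z) * G (monomial_at M 0 (Suc d # \<alpha>))"
    using len(1) by (simp only: sum_subtractf d) simp
  then have "(\<Sum>j\<in>?S. (d_op M G ?a - C_op M j G ?a) / of_nat M) =
    (of_nat (M - 1) * G (monomial_at M (Suc d) \<alpha>) - of_nat (M - Suc z) * G (monomial_at M 0 (Suc d # \<alpha>))) / of_nat M"
    by (simp only: sum_divide_distrib[symmetric])
  also have "\<dots> = of_nat (M - 1) / of_nat M * G (monomial_at M (Suc d) \<alpha>) -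
    of_nat (M - Suc z) / of_nat M * G (monomial_at M 0 (Suc d # \<alpha>))"
    by (simp add: diff_divide_distrib)
  also have "of_nat (M - 1) / of_nat M = (1 - of_nat 1 / of_nat M :: complex)"
    using len(1) by (simp add: of_nat_diff diff_divide_distrib)
  also have "of_nat (M - Suc z) / of_nat M = (1 - of_nat (Suc z) / of_nat M :: complex)"
    using zM by (simp add: of_nat_diff diff_divide_distrib del: of_nat_Suc)
  finally show ?thesis .
qed

lemma coeff_limit_Q_op:
  assumes "\<theta>s \<longlonglongrightarrow> \<theta>" and F: "coeff_limit F f" and G: "coeff_limit G g"
  shows "coeff_limit (\<lambda>M. Q_op \<theta>s M M (F M) (G M)) (limit_Q \<theta> f g)"
  unfolding coeff_limit_def
proof (intro conjI allI)
  have ev: "\<forall>\<^sub>F M in sequentially. F M \<in> sym_series M M" "\<forall>\<^sub>F M in sequentially. G M \<in> sym_series M M"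
    using F G by (simp_all add: coeff_limit_def)
  show "\<forall>\<^sub>F M in sequentially. Q_op \<theta>s M M (F M) (G M) \<in> sym_series M M"
    using ev eventually_ge_at_top[of 1] by eventually_elim (auto intro: Q_op_sym_series)
  fix d :: nat and \<alpha> :: "nat list"
  define z where "z = size (filter_mset (\<lambda>p. 0 < p) (mset \<alpha>))"
  have 1: "(\<lambda>M. 1 - of_nat c / of_nat M :: complex) \<longlonglongrightarrow> 1" for c
    using tendsto_diff[OF tendsto_const lim_const_over_n[of "of_nat c"]] by simp
  have Gl: "(\<lambda>M. G M (monomial_at M d' \<beta>)) \<longlonglongrightarrow> g d' \<beta>" for d' \<beta>
    using G by (simp add: coeff_limit_def)
  have "(\<lambda>M. \<theta>s M * ((1 - of_nat 1 / of_nat M) * G M (monomial_at M (Suc d) \<alpha>) -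
      (1 - of_nat (Suc z) / of_nat M) * G M (monomial_at M 0 (Suc d # \<alpha>))) +
      times_series (F M) (G M) (monomial_at M d \<alpha>)) \<longlonglongrightarrow>
      \<theta> * (1 * g (Suc d) \<alpha> - 1 * g 0 (Suc d # \<alpha>)) + limit_times f g d \<alpha>"
    by (intro tendsto_add tendsto_mult tendsto_diff 1 Gl assms(1) tendsto_times_series F G)
  then have lim: "(\<lambda>M. \<theta>s M * ((1 - of_nat 1 / of_nat M) * G M (monomial_at M (Suc d) \<alpha>) -
      (1 - of_nat (Suc z) / of_nat M) * G M (monomial_at M 0 (Suc d # \<alpha>))) +
      times_series (F M) (G M) (monomial_at M d \<alpha>)) \<longlonglongrightarrow> limit_Q \<theta> f g d \<alpha>"
    unfolding limit_Q_def mult_1 .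
  show "(\<lambda>M. Q_op \<theta>s M M (F M) (G M) (monomial_at M d \<alpha>)) \<longlonglongrightarrow> limit_Q \<theta> f g d \<alpha>"
  proof (rule Lim_transform_eventually[OF lim])
    show "\<forall>\<^sub>F M in sequentially.
      \<theta>s M * ((1 - of_nat 1 / of_nat M) * G M (monomial_at M (Suc d) \<alpha>) -
      (1 - of_nat (Suc z) / of_nat M) * G M (monomial_at M 0 (Suc d # \<alpha>))) +
      times_series (F M) (G M) (monomial_at M d \<alpha>) = Q_op \<theta>s M M (F M) (G M) (monomial_at M d \<alpha>)"
      using ev(2) eventually_gt_at_top[of "Suc (length \<alpha>)"]
    proof eventually_elim
      case (elim M)
      show ?case unfolding Q_op_def sum_d_op_C_op[OF elim] z_def ..
    qed
  qed
qed

lemma coeff_limit_Q_op_funpow: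
  assumes "\<theta>s \<longlonglongrightarrow> \<theta>" "coeff_limit F f" "coeff_limit G g"
  shows "coeff_limit (\<lambda>M. (Q_op \<theta>s M M (F M) ^^ k) (G M)) ((limit_Q \<theta> f ^^ k) g)"
proof (induction k)
  case (Suc k)
  then show ?case using coeff_limit_Q_op[OF assms(1,2) Suc] by simp
qed (use assms in simp)

lemma moment_seq_limit_Q_funpow:
  assumes "\<theta>s \<longlonglongrightarrow> \<theta>" "coeff_limit F f" "coeff_limit G g"
  shows "moment_seq \<theta> ((limit_Q \<theta> f ^^ k) g) = (lukasiewicz_step (moment_seq \<theta> f) ^^ k) (moment_seq \<theta> g)"
proof (induction k)
  case (Suc k)
  have "moment_seq \<theta> (limit_Q \<theta> f ((limit_Q \<theta> f ^^ k) g)) =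
    lukasiewicz_step (moment_seq \<theta> f) (moment_seq \<theta> ((limit_Q \<theta> f ^^ k) g))"
    using coeff_limit_zero_insensitive[OF assms(2)]
      coeff_limit_zero_insensitive[OF coeff_limit_Q_op_funpow[OF assms, of k]]
    by (intro ext) (simp add: moment_seq_limit_Q lukasiewicz_step_def)
  then show ?case using Suc by simp
qed simp

section \<open>Eliminating the last variable\<close>

lemma sym_series_set_zero:
  assumes "F \<in> sym_series (Suc M) (Suc M)"
  shows "set_zero (Suc M) F \<in> sym_series M M"
proof (rule sym_seriesI)
  fix a :: monomial assume a: "\<not> keys a \<subseteq> {1..M}"
  show "set_zero (Suc M) F a = 0"
  proof (cases "lookup a (Suc M) = 0")
    case True
    then have "Suc M \<notin> keys a" by (simp add: in_keys_iff)
    then have "\<not> keys a \<subseteq> {1..Suc M}" using a by (auto simp: atLeastAtMostSuc_conv)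
    then show ?thesis using sym_series_support[OF assms] by (simp add: set_zero_def)
  qed (simp add: set_zero_def)
next
  fix \<sigma> and a :: monomial assume \<sigma>: "\<sigma> permutes ({1..M} - {M})"
  have "\<sigma> permutes ({1..Suc M} - {Suc M})" by (rule permutes_subset[OF \<sigma>]) auto
  then have "F (map_key \<sigma> a) = F a" by (rule sym_series_permute[OF assms])
  moreover have "\<sigma> (Suc M) = Suc M" using permutes_not_in[OF \<sigma>] by simp
  then have "lookup (map_key \<sigma> a) (Suc M) = lookup a (Suc M)"
    by (simp add: lookup_map_key_permutes[OF \<sigma>])
  ultimately show "set_zero (Suc M) F (map_key \<sigma> a) = set_zero (Suc M) F a"
    by (simp add: set_zero_def)
qed

text \<open>What remains is symmetric in all M variables, so x_M may serve as the distinguished one.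
  A monomial with exponent d there and \<alpha> elsewhere is, before the elimination, one with
  exponent 0 at x_(M+1) and the list d # \<alpha>.\<close>

lemma coeff_limit_set_zero:
  assumes "coeff_limit G g"
  shows "coeff_limit (\<lambda>M. set_zero (Suc M) (G (Suc M))) (\<lambda>d \<alpha>. g 0 (d # \<alpha>))"
  unfolding coeff_limit_def
proof (intro conjI allI)
  have "\<forall>\<^sub>F M in sequentially. G M \<in> sym_series M M" using assms by (simp add: coeff_limit_def)
  then have ev: "\<forall>\<^sub>F M in sequentially. G (Suc M) \<in> sym_series (Suc M) (Suc M)"
    by (rule eventually_all_ge_at_top[THEN eventually_mono]) auto
  then show "\<forall>\<^sub>F M in sequentially. set_zero (Suc M) (G (Suc M)) \<in> sym_series M M"
    by (rule eventually_mono) (rule sym_series_set_zero)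
  fix d :: nat and \<alpha> :: "nat list"
  have "(\<lambda>M. G (Suc M) (monomial_at (Suc M) 0 (d # \<alpha>))) \<longlonglongrightarrow> g 0 (d # \<alpha>)"
    using assms by (intro LIMSEQ_Suc) (simp add: coeff_limit_def)
  then show "(\<lambda>M. set_zero (Suc M) (G (Suc M)) (monomial_at M d \<alpha>)) \<longlonglongrightarrow> g 0 (d # \<alpha>)"
  proof (rule Lim_transform_eventually)
    show "\<forall>\<^sub>F M in sequentially. G (Suc M) (monomial_at (Suc M) 0 (d # \<alpha>)) =
        set_zero (Suc M) (G (Suc M)) (monomial_at M d \<alpha>)"
      using ev eventually_gt_at_top[of "length \<alpha>"]
    proof eventually_elim
      case (elim M)
      let ?a = "monomial_at M d \<alpha>"
      have keys: "keys ?a \<subseteq> {1..M}" by (rule keys_monomial_at[OF elim(2)])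
      then have "Suc M \<notin> keys ?a" by force
      then have zero: "lookup ?a (Suc M) = 0" by (simp add: in_keys_iff)
      have len: "length (d # \<alpha>) < Suc M" using elim(2) by simp
      have notin: "M \<notin> keys (monomial_of_list \<alpha>)" "Suc M \<notin> keys (monomial_of_list \<alpha>)"
        using keys_monomial_of_list[of \<alpha>] elim(2) by force+
      have "other_exponents (Suc M) (monomial_of_list \<alpha>) = filter_mset (\<lambda>p. 0 < p) (mset \<alpha>)"
        using other_exponents_monomial_at[of \<alpha> "Suc M" 0] elim(2) by (simp add: monomial_at_def)
      then have "other_exponents (Suc M) ?a = filter_mset (\<lambda>p. 0 < p) (mset (d # \<alpha>))"
        by (simp add: monomial_at_def other_exponents_add_single[OF notin(1)])
      then have "G (Suc M) (monomial_at (Suc M) 0 (d # \<alpha>)) = G (Suc M) ?a"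
        using keys zero keys_monomial_at[OF len, of 0] lookup_monomial_at[OF len, of 0]
          other_exponents_monomial_at[OF len, of 0]
        by (intro sym_series_eqI[OF elim(1)]) auto
      then show ?case by (simp add: set_zero_def zero)
    qed
  qed
qed

lemma coeff_limit_symmetric_outside:
  assumes "symmetric_outside 1 (\<lambda>M. swap_vars 1 M (h M)) s"
    and "\<forall>\<^sub>F M in sequentially. h M \<in> sym_series M M"
  shows "coeff_limit h (\<lambda>d \<alpha>. s d (partition_of \<alpha>))"
  unfolding coeff_limit_def
proof (intro conjI allI assms(2))
  fix d :: nat and \<alpha> :: "nat list"
  have "(\<lambda>M. coeff_series 1 M (swap_vars 1 M (h M)) d (partition_of \<alpha>)) \<longlonglongrightarrow> s d (partition_of \<alpha>)"
    using assms(1) partition_of_in_partitions by (simp add: symmetric_outside_def)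
  moreover have "\<forall>\<^sub>F M in sequentially. swap_vars 1 M (h M) \<in> sym_series 1 M"
    using assms(1) by (simp add: symmetric_outside_def)
  then have "\<forall>\<^sub>F M in sequentially.
      coeff_series 1 M (swap_vars 1 M (h M)) d (partition_of \<alpha>) = h M (monomial_at M d \<alpha>)"
    using eventually_gt_at_top[of "length \<alpha>"]
    by eventually_elim (rule coeff_series_swap_vars)
  ultimately show "(\<lambda>M. h M (monomial_at M d \<alpha>)) \<longlonglongrightarrow> s d (partition_of \<alpha>)"
    by (rule Lim_transform_eventually)
qed

text \<open>The new sequence is a scalar multiple of that of the series 1. The next factor thus
  starts afresh, up to this scalar, and the limit becomes a product.\<close>

lemma coeff_limit_R_op:
  assumes "\<theta>s \<longlonglongrightarrow> \<theta>" "coeff_limit F f" "coeff_limit G g"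
  obtains s where "coeff_limit (\<lambda>M. R_op \<theta>s (Suc M) (Suc M) k (F (Suc M)) (G (Suc M))) s"
    "moment_seq \<theta> s = (\<lambda>n. if n = 0 then (lukasiewicz_step (moment_seq \<theta> f) ^^ k) (moment_seq \<theta> g) 0 else 0)"
proof
  let ?q = "(limit_Q \<theta> f ^^ k) g"
  have q: "coeff_limit (\<lambda>M. (Q_op \<theta>s M M (F M) ^^ k) (G M)) ?q"
    by (rule coeff_limit_Q_op_funpow[OF assms])
  show "coeff_limit (\<lambda>M. R_op \<theta>s (Suc M) (Suc M) k (F (Suc M)) (G (Suc M))) (\<lambda>d \<alpha>. ?q 0 (d # \<alpha>))"
    unfolding R_op_def by (rule coeff_limit_set_zero[OF q])
  have "?q 0 [] = moment_seq \<theta> ?q 0" by (simp add: moment_seq_def alt_sum_0)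
  then show "moment_seq \<theta> (\<lambda>d \<alpha>. ?q 0 (d # \<alpha>)) =
    (\<lambda>n. if n = 0 then (lukasiewicz_step (moment_seq \<theta> f) ^^ k) (moment_seq \<theta> g) 0 else 0)"
    using moment_seq_set_zero[of ?q \<theta>, OF coeff_limit_zero_insensitive[OF q]]
      moment_seq_limit_Q_funpow[OF assms, of k] by (simp add: fun_eq_iff)
qed

lemma lukasiewicz_step_funpow_scale:
  "(lukasiewicz_step \<kappa> ^^ k) (\<lambda>n. c * w n) = (\<lambda>n. c * (lukasiewicz_step \<kappa> ^^ k) w n)"
proof (induction k)
  case (Suc k)
  then show ?case
    by (simp add: lukasiewicz_step_def fun_eq_iff sum_distrib_left distrib_left mult.left_commute)
qed simp

lemma op_prod_Suc: "op_prod (Suc r) T x = T (Suc r) (op_prod r T x)"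
  by (simp add: op_prod_def)

theorem theorem2p13:
  fixes \<theta> :: complex
    and \<theta>s :: "nat \<Rightarrow> complex"
    and lam :: "nat list"
    and m :: nat
    and f :: "nat \<Rightarrow> nat \<Rightarrow> mseries"
    and g :: "nat \<Rightarrow> mseries"
    and flim :: "nat \<Rightarrow> nat \<Rightarrow> nat list \<Rightarrow> complex"
    and glim :: "nat \<Rightarrow> nat list \<Rightarrow> complex"
  assumes "\<theta>s \<longlonglongrightarrow> \<theta>"
    and "lam \<in> partitions" and "length lam = m" and "m \<ge> 1"
    and "\<And>i N. 1 \<le> i \<Longrightarrow> i \<le> m \<Longrightarrow> m \<le> N \<Longrightarrow> f i N \<in> sym_series (N - i + 1) (N - i + 1)"
    and "\<And>N. m \<le> N \<Longrightarrow> g N \<in> sym_series N N"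
    \<comment> \<open>\<open>f i N\<close> has \<open>M = N - i + 1\<close> variables, that is, \<open>N = M + i - 1\<close>.\<close>
    and "\<And>i. 1 \<le> i \<Longrightarrow> i \<le> m \<Longrightarrow>
           symmetric_outside 1 (\<lambda>M. swap_vars 1 M (f i (M + i - 1))) (flim i)"
    and "symmetric_outside 1 (\<lambda>M. swap_vars 1 M (g M)) glim"
  shows "(\<lambda>N. const_term
            (op_prod m (\<lambda>i. R_op \<theta>s (N - i + 1) (N - i + 1) (lam ! (i - 1)) (f i N)) (g N)))
         \<longlonglongrightarrow>
           (\<Sum>\<pi>\<in>NC (lam ! 0 + 1).
              free_cumulant \<theta> glim (card (nth_block \<pi> 1)) *
              (\<Prod>j=2..card \<pi>. free_cumulant \<theta> (flim 1) (card (nth_block \<pi> j)))) *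
           (\<Prod>i=2..m. \<Sum>\<pi>\<in>NC (lam ! (i - 1)).
              \<Prod>j=1..card \<pi>. free_cumulant \<theta> (flim i) (card (nth_block \<pi> j)))"
proof -
  define H where "H r N = op_prod r (\<lambda>i. R_op \<theta>s (N - i + 1) (N - i + 1) (lam ! (i - 1)) (f i N)) (g N)" for r N
  define \<kappa> where "\<kappa> i n = free_cumulant \<theta> (flim i) (Suc n)" for i n
  define A where "A = (\<Sum>\<pi>\<in>NC (lam ! 0 + 1). free_cumulant \<theta> glim (card (nth_block \<pi> 1)) *
              (\<Prod>j=2..card \<pi>. free_cumulant \<theta> (flim 1) (card (nth_block \<pi> j))))"
  define B where "B i = (\<Sum>\<pi>\<in>NC (lam ! (i - 1)).
              \<Prod>j=1..card \<pi>. free_cumulant \<theta> (flim i) (card (nth_block \<pi> j)))" for i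
  have A: "A = (lukasiewicz_step (\<kappa> 1) ^^ (lam ! 0)) (\<lambda>n. free_cumulant \<theta> glim (Suc n)) 0"
    unfolding A_def \<kappa>_def by (rule sum_NC_first_block)
  have B: "B i = (lukasiewicz_step (\<kappa> i) ^^ (lam ! (i - 1))) (\<lambda>n. if n = 0 then 1 else 0) 0"
    if "i \<in> {1..m}" for i
  proof -
    have "i - 1 < length lam" using that assms(3) by auto
    then have "lam ! (i - 1) \<ge> 1" using assms(2) nth_mem[of "i - 1" lam] by (auto simp: partitions_def Suc_le_eq)
    then show ?thesis unfolding B_def \<kappa>_def by (rule sum_NC)
  qed
  have g_lim: "coeff_limit g (\<lambda>d \<alpha>. glim d (partition_of \<alpha>))"
    using assms(6) by (intro coeff_limit_symmetric_outside assms(8)) (auto simp: eventually_sequentially)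
  have f_lim: "coeff_limit (\<lambda>M. f i (M + i - 1)) (\<lambda>d \<alpha>. flim i d (partition_of \<alpha>))" if "i \<in> {1..m}" for i
  proof (intro coeff_limit_symmetric_outside assms(7))
    have "f i (M + i - 1) \<in> sym_series M M" if "M \<ge> m" for M
      using assms(5)[of i "M + i - 1"] \<open>i \<in> {1..m}\<close> that by auto
    then show "\<forall>\<^sub>F M in sequentially. f i (M + i - 1) \<in> sym_series M M"
      by (auto simp: eventually_sequentially)
  qed (use that in auto)
  have \<kappa>: "moment_seq \<theta> (\<lambda>d \<alpha>. flim i d (partition_of \<alpha>)) = \<kappa> i" for i
    by (simp add: fun_eq_iff \<kappa>_def free_cumulant_eq_moment_seq)
  \<comment> \<open>Each factor removes one variable, so that \<open>H r N\<close> has N - r of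
    them; setting N = M + r makes M the number of variables.\<close>
  have step: "\<exists>s'. coeff_limit (\<lambda>M. H (Suc r) (M + Suc r)) s' \<and>
      moment_seq \<theta> s' = (\<lambda>n. if n = 0 then (lukasiewicz_step (\<kappa> (Suc r)) ^^ (lam ! r)) (moment_seq \<theta> s) 0 else 0)"
    if s: "coeff_limit (\<lambda>M. H r (M + r)) s" and r: "Suc r \<le> m" for r s
  proof -
    obtain s' where s': "coeff_limit (\<lambda>M. R_op \<theta>s (Suc M) (Suc M) (lam ! r) (f (Suc r) (Suc M + Suc r - 1)) (H r (Suc M + r))) s'"
      "moment_seq \<theta> s' = (\<lambda>n. if n = 0 then (lukasiewicz_step (moment_seq \<theta> (\<lambda>d \<alpha>. flim (Suc r) d (partition_of \<alpha>))) ^^ (lam ! r)) (moment_seq \<theta> s) 0 else 0)"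
      using coeff_limit_R_op[OF assms(1) f_lim[of "Suc r"] s, of "lam ! r"] r by auto
    \<comment> \<open>With N = M + r + 1 the factor of index r + 1 acts on N - (r + 1) + 1 = M + 1
      variables, and (M + 1) + (r + 1) - 1 = N.\<close>
    moreover have "R_op \<theta>s (Suc M) (Suc M) (lam ! r) (f (Suc r) (Suc M + Suc r - 1)) (H r (Suc M + r)) = H (Suc r) (M + Suc r)" for M
      by (simp add: H_def op_prod_Suc)
    ultimately show ?thesis unfolding \<kappa> by auto
  qed
  \<comment> \<open>The induction begins after the first factor, which still sees all free cumulants
    of \<open>g\<close> and yields \<open>A\<close>; every later factor starts from a
    scalar.\<close>
  have "\<exists>s. coeff_limit (\<lambda>M. H (Suc r) (M + Suc r)) s \<and>
      moment_seq \<theta> s = (\<lambda>n. if n = 0 then A * (\<Prod>i=2..Suc r. B i) else 0)" if "Suc r \<le> m" for r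
    using that
  proof (induction r)
    case 0
    have "coeff_limit (\<lambda>M. H 0 (M + 0)) (\<lambda>d \<alpha>. glim d (partition_of \<alpha>))"
      using g_lim by (simp add: H_def op_prod_def)
    moreover have "moment_seq \<theta> (\<lambda>d \<alpha>. glim d (partition_of \<alpha>)) = (\<lambda>n. free_cumulant \<theta> glim (Suc n))"
      by (simp add: fun_eq_iff free_cumulant_eq_moment_seq)
    then have "(lukasiewicz_step (\<kappa> (Suc 0)) ^^ (lam ! 0)) (moment_seq \<theta> (\<lambda>d \<alpha>. glim d (partition_of \<alpha>))) 0 =
      A * (\<Prod>i=2..Suc 0. B i)"
      by (simp add: A)
    ultimately show ?case using step[of 0, OF _ 0] by metis
  next
    case (Suc r)
    then obtain s where s: "coeff_limit (\<lambda>M. H (Suc r) (M + Suc r)) s"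
      "moment_seq \<theta> s = (\<lambda>n. if n = 0 then A * (\<Prod>i=2..Suc r. B i) else 0)" by auto
    let ?c = "A * (\<Prod>i=2..Suc r. B i)"
    have "moment_seq \<theta> s = (\<lambda>n. ?c * (if n = 0 then 1 else 0))" by (simp add: s(2) fun_eq_iff)
    then have "(lukasiewicz_step (\<kappa> (Suc (Suc r))) ^^ (lam ! Suc r)) (moment_seq \<theta> s) 0 = ?c * B (Suc (Suc r))"
      using B[of "Suc (Suc r)"] Suc.prems by (simp add: lukasiewicz_step_funpow_scale)
    also have "\<dots> = A * (\<Prod>i=2..Suc (Suc r). B i)" by simp
    finally have eq: "(lukasiewicz_step (\<kappa> (Suc (Suc r))) ^^ (lam ! Suc r)) (moment_seq \<theta> s) 0 =
      A * (\<Prod>i=2..Suc (Suc r). B i)" .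
    show ?case using step[OF s(1) Suc.prems] unfolding eq .
  qed
  note * = this[of "m - 1"]
  have "Suc (m - 1) = m" using assms(4) by simp
  from *[unfolded this] obtain s where s: "coeff_limit (\<lambda>M. H m (M + m)) s"
    "moment_seq \<theta> s = (\<lambda>n. if n = 0 then A * (\<Prod>i=2..m. B i) else 0)"
    by blast
  have "s 0 [] = moment_seq \<theta> s 0" by (simp add: moment_seq_def alt_sum_0)
  then have "s 0 [] = A * (\<Prod>i=2..m. B i)" by (simp add: s(2))
  \<comment> \<open>\<open>monomial_at M 0 []\<close> is the monomial 1, so these values are the
    constant terms.\<close>
  moreover have "(\<lambda>M. H m (M + m) (monomial_at M 0 [])) \<longlonglongrightarrow> s 0 []"
    using s(1) by (simp add: coeff_limit_def)
  ultimately have "(\<lambda>M. const_term (H m (M + m))) \<longlonglongrightarrow> A * (\<Prod>i=2..m. B i)"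
    by (simp add: const_term_def monomial_at_def)
  then have "(\<lambda>N. const_term (H m N)) \<longlonglongrightarrow> A * (\<Prod>i=2..m. B i)" by (rule LIMSEQ_offset)
  then show ?thesis unfolding H_def A_def B_def .
qed

end
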